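(* Let $\Delta t>0$ and $n\ge0$. Given $u_h^n\in V_h$ and $U^n\in C^0(\Omega)$, consider the scheme: find $u_h^{n+1}\in V_h$ and $U^{n+1}\in C^0(\Omega)$ such that for all $\phi\in V_h$ $$\left(\frac{u_h^{n+1}-u_h^n}{\Delta t},\phi\right)=-A(\epsilon^2;u_h^{n+1},\phi)-\left(H(u_h^n)U^{n+1},\phi\right),$$ $$\frac{U^{n+1}-U^n}{\Delta t}=\frac12H(u_h^n)\frac{u_h^{n+1}-u_h^n}{\Delta t}\quad\text{(pointwise)}.$$ Then for any $\Delta t>0$ the scheme admits a unique solution $u_h^{n+1}\in V_h$, $U^{n+1}\in C^0(\Omega)$, and it satisfies the energy dissipation law $$E(u_h^{n+1},U^{n+1})=E(u_h^n,U^n)-\frac1{\Delta t}\|u_h^{n+1}-u_h^n\|^2-\frac12A(\epsilon^2;u_h^{n+1}-u_h^n,u_h^{n+1}-u_h^n)-\|U^{n+1}-U^n\|^2.$$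
   Context: $\Omega\subset\mathbb{R}^d$ ($d=2,3$) is a bounded domain and $\epsilon>0$ is a constant. $\mathcal T$ is a quasi-uniform triangulation $\Omega=\cup_{i=1}^N T_i$, and $V_h=\{v\in C^0(\Omega)\cap H^1(\Omega): v|_{T_i}\in P_k\ \forall T_i\in\mathcal T\}$, where $P_k$ is the space of polynomials of degree at most $k$ ($k\ge1$ fixed). $C^0(\Omega)$ denotes functions continuous on $\overline\Omega$. $(\cdot,\cdot)$ and $\|\cdot\|$ are the $L^2(\Omega)$ inner product and norm. For a coefficient $a(x)$, $A(a;q,v)=\int_\Omega a(x)\nabla q\cdot\nabla v\,dx$. The potential $F$ is a $C^1$ function on an interval $I\subseteq\mathbb{R}$ (e.g. $F(u)=\frac14(u^2-1)^2$ with $I=\mathbb{R}$, or the logarithmic Flory–Huggins potential with $I=(0,1)$). The constant $B\ge0$ is such that $F+B>0$, and $H(w)=F'(w)/\sqrt{F(w)+B}$. It is a standing assumption that all functions at which $F,F',H$ are evaluated take values (on $\overline\Omega$) where these are defined and $F+B>0$. The energy is $E(v,V)=\frac12A(\epsilon^2;v,v)+\int_\Omega V^2\,dx-B|\Omega|$. *)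

theory Defs
  imports "HOL-Analysis.Analysis"
begin

text \<open>
  Functions on \<open>\<Omega>\<close> or on its closure are total functions on \<open>real ^ 'n\<close> whose
  values outside that set are irrelevant: every notion below only looks at the relevant set.
\<close>

definition L2 :: "(real ^ 'n) set \<Rightarrow> (real ^ 'n \<Rightarrow> real) \<Rightarrow> bool" where
  "L2 \<Omega> f \<longleftrightarrow> set_borel_measurable lebesgue \<Omega> f \<and> set_integrable lebesgue \<Omega> (\<lambda>x. (f x)\<^sup>2)"

definition l2_inner :: "(real ^ 'n) set \<Rightarrow> (real ^ 'n \<Rightarrow> real) \<Rightarrow> (real ^ 'n \<Rightarrow> real) \<Rightarrow> real" where
  "l2_inner \<Omega> f g = (LINT x:\<Omega>|lebesgue. f x * g x)"

definition l2_norm :: "(real ^ 'n) set \<Rightarrow> (real ^ 'n \<Rightarrow> real) \<Rightarrow> real" where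
  "l2_norm \<Omega> f = sqrt (l2_inner \<Omega> f f)"

definition partial_deriv :: "'n \<Rightarrow> (real ^ 'n \<Rightarrow> real) \<Rightarrow> real ^ 'n \<Rightarrow> real" where
  "partial_deriv i f x = frechet_derivative f (at x) (axis i 1)"

primrec C_k :: "nat \<Rightarrow> (real ^ 'n \<Rightarrow> real) \<Rightarrow> bool" where
  "C_k 0 f \<longleftrightarrow> continuous_on UNIV f"
| "C_k (Suc m) f \<longleftrightarrow> (\<forall>x. f differentiable (at x)) \<and> (\<forall>i. C_k m (partial_deriv i f))"

text \<open>The test functions \<open>C\<^sub>c\<^sup>\<infinity>(\<Omega>)\<close>, extended by zero to the whole space.\<close>

definition test_function :: "(real ^ 'n) set \<Rightarrow> (real ^ 'n \<Rightarrow> real) \<Rightarrow> bool" where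
  "test_function \<Omega> \<psi> \<longleftrightarrow>
     (\<forall>m. C_k m \<psi>) \<and> (\<exists>K. compact K \<and> K \<subseteq> \<Omega> \<and> (\<forall>x. x \<notin> K \<longrightarrow> \<psi> x = 0))"

definition is_weak_grad :: "(real ^ 'n) set \<Rightarrow> (real ^ 'n \<Rightarrow> real) \<Rightarrow> (real ^ 'n \<Rightarrow> real ^ 'n) \<Rightarrow> bool" where
  "is_weak_grad \<Omega> v g \<longleftrightarrow>
     (\<forall>i. L2 \<Omega> (\<lambda>x. g x $ i)) \<and>
     (\<forall>\<psi> i. test_function \<Omega> \<psi> \<longrightarrow>
        (LINT x:\<Omega>|lebesgue. v x * partial_deriv i \<psi> x) = - (LINT x:\<Omega>|lebesgue. g x $ i * \<psi> x))"

definition H1 :: "(real ^ 'n) set \<Rightarrow> (real ^ 'n \<Rightarrow> real) \<Rightarrow> bool" where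
  "H1 \<Omega> v \<longleftrightarrow> L2 \<Omega> v \<and> (\<exists>g. is_weak_grad \<Omega> v g)"

text \<open>A representative of the weak gradient, which is determined up to a null set;
  only meaningful for \<open>v\<close> in \<open>H\<^sup>1(\<Omega>)\<close>.\<close>

definition weak_grad :: "(real ^ 'n) set \<Rightarrow> (real ^ 'n \<Rightarrow> real) \<Rightarrow> real ^ 'n \<Rightarrow> real ^ 'n" where
  "weak_grad \<Omega> v = (SOME g. is_weak_grad \<Omega> v g)"

definition A_form ::
  "(real ^ 'n) set \<Rightarrow> (real ^ 'n \<Rightarrow> real) \<Rightarrow> (real ^ 'n \<Rightarrow> real) \<Rightarrow> (real ^ 'n \<Rightarrow> real) \<Rightarrow> real" where
  "A_form \<Omega> a q v = (LINT x:\<Omega>|lebesgue. a x * (weak_grad \<Omega> q x \<bullet> weak_grad \<Omega> v x))"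

text \<open>
  The elements are closed nondegenerate simplices of full dimension, so the decomposition
  of the open set \<open>\<Omega>\<close> into elements is read as one of its closure. The library notion
  \<^const>\<open>triangulation\<close> gives finiteness and conformity.
\<close>

definition mesh :: "(real ^ 'n) set \<Rightarrow> (real ^ 'n) set set \<Rightarrow> bool" where
  "mesh \<Omega> \<T> \<longleftrightarrow>
     triangulation \<T> \<and> (\<forall>T\<in>\<T>. int CARD('n) simplex T) \<and> closure \<Omega> = \<Union>\<T>"

text \<open>Quasi-uniformity with constant \<open>\<sigma>\<close>: every element contains a ball whose radius is
  comparable to the global mesh size.\<close>

definition quasi_uniform :: "real \<Rightarrow> (real ^ 'n) set set \<Rightarrow> bool" where
  "quasi_uniform \<sigma> \<T> \<longleftrightarrow>
     (\<forall>T\<in>\<T>. \<exists>x r. 0 < r \<and> cball x r \<subseteq> T \<and> (\<forall>T'\<in>\<T>. diameter T' \<le> \<sigma> * r))"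

text \<open>Polynomial functions of total degree at most \<open>k\<close>; a multi-index is a function on the
  finite type \<open>'n\<close>, so the index set of the sum is finite.\<close>

definition P_space :: "nat \<Rightarrow> (real ^ 'n \<Rightarrow> real) set" where
  "P_space k =
     {p. \<exists>c :: ('n \<Rightarrow> nat) \<Rightarrow> real.
           p = (\<lambda>x. \<Sum>\<alpha> | (\<Sum>i\<in>UNIV. \<alpha> i) \<le> k. c \<alpha> * (\<Prod>i\<in>UNIV. (x $ i) ^ \<alpha> i))}"

definition C0 :: "(real ^ 'n) set \<Rightarrow> (real ^ 'n \<Rightarrow> real) set" where
  "C0 \<Omega> = {v. continuous_on (closure \<Omega>) v}"

definition V_h :: "(real ^ 'n) set \<Rightarrow> (real ^ 'n) set set \<Rightarrow> nat \<Rightarrow> (real ^ 'n \<Rightarrow> real) set" where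
  "V_h \<Omega> \<T> k = {v. v \<in> C0 \<Omega> \<and> H1 \<Omega> v \<and> (\<forall>T\<in>\<T>. \<exists>p\<in>P_space k. \<forall>x\<in>T. v x = p x)}"

definition energy ::
  "(real ^ 'n) set \<Rightarrow> real \<Rightarrow> real \<Rightarrow> (real ^ 'n \<Rightarrow> real) \<Rightarrow> (real ^ 'n \<Rightarrow> real) \<Rightarrow> real" where
  "energy \<Omega> \<epsilon> B v V =
     1 / 2 * A_form \<Omega> (\<lambda>_. \<epsilon>\<^sup>2) v v + (LINT x:\<Omega>|lebesgue. (V x)\<^sup>2) - B * measure lebesgue \<Omega>"

text \<open>\<open>F'\<close> is the derivative of \<open>F\<close> on the interval \<open>I\<close>, one-sided at endpoints in \<open>I\<close>.\<close>

definition C1_potential :: "real set \<Rightarrow> (real \<Rightarrow> real) \<Rightarrow> (real \<Rightarrow> real) \<Rightarrow> bool" where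
  "C1_potential I F F' \<longleftrightarrow>
     is_interval I \<and> (\<forall>w\<in>I. (F has_real_derivative F' w) (at w within I)) \<and> continuous_on I F'"

definition H_fun :: "(real \<Rightarrow> real) \<Rightarrow> (real \<Rightarrow> real) \<Rightarrow> real \<Rightarrow> real \<Rightarrow> real" where
  "H_fun F F' B w = F' w / sqrt (F w + B)"

text \<open>\<open>(u', U')\<close> is a solution of one time step of the scheme starting from \<open>(u, U)\<close>.\<close>

definition scheme_solution ::
  "(real ^ 'n) set \<Rightarrow> (real ^ 'n) set set \<Rightarrow> nat \<Rightarrow> real \<Rightarrow> (real \<Rightarrow> real) \<Rightarrow> real \<Rightarrow>
   (real ^ 'n \<Rightarrow> real) \<Rightarrow> (real ^ 'n \<Rightarrow> real) \<Rightarrow> (real ^ 'n \<Rightarrow> real) \<Rightarrow> (real ^ 'n \<Rightarrow> real) \<Rightarrow> bool" where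
  "scheme_solution \<Omega> \<T> k \<epsilon> H dt u U u' U' \<longleftrightarrow>
     u' \<in> V_h \<Omega> \<T> k \<and> U' \<in> C0 \<Omega> \<and>
     (\<forall>\<phi>\<in>V_h \<Omega> \<T> k.
        l2_inner \<Omega> (\<lambda>x. (u' x - u x) / dt) \<phi> =
          - A_form \<Omega> (\<lambda>_. \<epsilon>\<^sup>2) u' \<phi> - l2_inner \<Omega> (\<lambda>x. H (u x) * U' x) \<phi>) \<and>
     (\<forall>x\<in>closure \<Omega>. (U' x - U x) / dt = 1 / 2 * H (u x) * ((u' x - u x) / dt))"

end

theory Submission
  imports Defs
begin

text \<open>
  The auxiliary variable enters the scheme linearly, with a coefficient \<open>h = H (u\<^sup>n)\<close> taken from
  the previous step. Eliminating it by means of the pointwise equation leaves one linear problem in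
  the finite element space, whose bilinear form
    \<open>a(v, \<phi>) = (v, \<phi>) / \<Delta>t + A(\<epsilon>\<^sup>2; v, \<phi>) + 1/2 (h v, h \<phi>)\<close>
  is symmetric and positive definite for every \<open>\<Delta>t > 0\<close> (\<open>scheme_solution_iff\<close>,
  \<open>step_form_definite\<close>). Unique solvability is therefore the Riesz representation theorem in finite
  dimension (\<open>riesz_representation\<close>, \<open>orthonormal_card_bounded\<close>). The dissipation law comes from
  testing with the increment \<open>u\<^sup>n\<^sup>+\<^sup>1 - u\<^sup>n\<close>, which by the pointwise equation satisfies
  \<open>h (u\<^sup>n\<^sup>+\<^sup>1 - u\<^sup>n) = 2 (U\<^sup>n\<^sup>+\<^sup>1 - U\<^sup>n)\<close>, and from polarisation (\<open>energy_dissipation\<close>).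

  The analytic content is that \<open>A\<close> is bilinear at all: weak gradients are chosen representatives, so
  their additivity holds only almost everywhere, and only because weak gradients are unique
  (\<open>is_weak_grad_unique\<close>). Uniqueness is the fundamental lemma of the calculus of variations, which in
  turn requires enough smooth test functions. They are built from \<open>exp (- 1 / t)\<close> as
  products over the coordinates and approximate the indicators of boxes.
\<close>

section \<open>Smooth bump functions on boxes\<close>

text \<open>
  The classical flat function and its relatives: \<open>t\<^sup>-\<^sup>j exp (- 1 / t)\<close> on the positive half-line, zero
  elsewhere. The powers \<open>j\<close> make the family closed under differentiation up to linear combinations.
\<close>
definition flat :: "nat \<Rightarrow> real \<Rightarrow> real" where
  "flat j t = (if t > 0 then inverse t ^ j * exp (- inverse t) else 0)"

lemma tendsto_flat_at_right_0: "(flat j \<longlongrightarrow> 0) (at_right 0)"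
proof -
  have "((\<lambda>t::real. inverse t ^ j / exp (inverse t)) \<longlongrightarrow> 0) (at_right 0)"
    using tendsto_power_div_exp_0 filterlim_inverse_at_top_right by (rule filterlim_compose)
  moreover have "\<forall>\<^sub>F t in at_right 0. inverse t ^ j / exp (inverse t) = flat j t"
    unfolding eventually_at_right_field
    by (auto simp: flat_def exp_minus divide_inverse intro!: exI[of _ 1])
  ultimately show ?thesis by (rule Lim_transform_eventually)
qed

lemma DERIV_flat: "(flat j has_real_derivative flat (j + 2) t - real j * flat (j + 1) t) (at t)"
proof -
  consider "t > 0" | "t < 0" | "t = 0" by linarith
  then show ?thesis
  proof cases
    case 1
    have "((\<lambda>t. inverse t) has_real_derivative - (inverse t ^ 2)) (at t)"
      using 1 DERIV_inverse[of t] by (simp add: numeral_2_eq_2)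
    from DERIV_mult[OF DERIV_power[OF this, of j] DERIV_chain2[OF DERIV_exp DERIV_minus[OF this]]]
    have "((\<lambda>t. inverse t ^ j * exp (- inverse t)) has_real_derivative
        flat (j + 2) t - real j * flat (j + 1) t) (at t)"
      using 1 by (cases j) (simp_all add: flat_def algebra_simps power2_eq_square)
    moreover have "\<forall>\<^sub>F s in nhds t. inverse s ^ j * exp (- inverse s) = flat j s"
      using eventually_nhds_in_open[of "{0<..}" t] 1
      by (auto simp: flat_def elim!: eventually_mono)
    ultimately show ?thesis
      by (subst DERIV_cong_ev[OF refl _ refl, where g = "flat j", symmetric])
  next
    case 2
    have "\<forall>\<^sub>F s in nhds t. 0 = flat j s"
      using eventually_nhds_in_open[of "{..<0}" t] 2
      by (auto simp: flat_def elim!: eventually_mono)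
    moreover have "((\<lambda>_. 0) has_real_derivative flat (j + 2) t - real j * flat (j + 1) t) (at t)"
      using 2 by (simp add: flat_def)
    ultimately show ?thesis
      by (subst DERIV_cong_ev[OF refl _ refl, where g = "flat j", symmetric])
  next
    case 3
    \<comment> \<open>the difference quotient at \<open>0\<close> is the next member of the family\<close>
    have "((\<lambda>h. flat j h / h) \<longlongrightarrow> 0) (at_right 0)"
    proof (rule Lim_transform_eventually[OF tendsto_flat_at_right_0[of "Suc j"]])
      show "\<forall>\<^sub>F t in at_right 0. flat (Suc j) t = flat j t / t"
        unfolding eventually_at_right_field
        by (auto simp: flat_def divide_inverse intro!: exI[of _ 1])
    qed
    moreover have "((\<lambda>h. flat j h / h) \<longlongrightarrow> 0) (at_left 0)"
    proof (rule Lim_transform_eventually[OF tendsto_const])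
      show "\<forall>\<^sub>F t in at_left 0. 0 = flat j t / t"
        unfolding eventually_at_left_field
        by (auto simp: flat_def intro!: exI[of _ "-1"])
    qed
    ultimately have "((\<lambda>h. flat j h / h) \<longlongrightarrow> 0) (at 0)"
      by (rule filterlim_split_at[rotated])
    then show ?thesis using 3 by (simp add: DERIV_def flat_def)
  qed
qed

text \<open>
  A reservoir of smooth functions of several variables. It is closed under products because the
  test functions below are products over the coordinates, and under sums because the derivative of
  a product is a sum. Closure under partial derivatives then follows from that of the family
  \<^const>\<open>flat\<close>.
\<close>
inductive_set flat_algebra :: "(real ^ 'n \<Rightarrow> real) set" where
  const: "(\<lambda>_. c) \<in> flat_algebra"
| flat: "(\<lambda>x. flat j (c * x $ i + d)) \<in> flat_algebra"
| add: "f \<in> flat_algebra \<Longrightarrow> g \<in> flat_algebra \<Longrightarrow> (\<lambda>x. f x + g x) \<in> flat_algebra"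
| mult: "f \<in> flat_algebra \<Longrightarrow> g \<in> flat_algebra \<Longrightarrow> (\<lambda>x. f x * g x) \<in> flat_algebra"

lemma flat_algebra_has_derivative:
  assumes "f \<in> flat_algebra"
  shows "\<exists>D. (\<forall>i. D i \<in> flat_algebra) \<and>
    (\<forall>x. (f has_derivative (\<lambda>h. \<Sum>i\<in>UNIV. D i x * h $ i)) (at x))"
  using assms
proof induction
  case (const c)
  show ?case
    by (rule exI[of _ "\<lambda>i _. 0"]) (auto intro: flat_algebra.const)
next
  case (flat j c i d)
  define D where "D = (\<lambda>k x. (if k = i then c else 0) *
    (flat (j + 2) (c * x $ i + d) + (- real j) * flat (j + 1) (c * x $ i + d)))"
  have "D k \<in> flat_algebra" for k
    unfolding D_def
    by (intro flat_algebra.mult flat_algebra.add flat_algebra.const flat_algebra.flat)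
  moreover have "((\<lambda>x. flat j (c * x $ i + d)) has_derivative
      (\<lambda>h. \<Sum>k\<in>UNIV. D k x * h $ k)) (at x)" for x
  proof -
    have "(flat j has_derivative (\<lambda>s. (flat (j + 2) (c * x $ i + d) - real j * flat (j + 1) (c * x $ i + d)) * s))
      (at (c * x $ i + d))"
      using DERIV_flat[of j "c * x $ i + d"] by (simp add: has_field_derivative_def)
    moreover have "((\<lambda>x. c * x $ i + d) has_derivative (\<lambda>h. c * h $ i)) (at x)"
      by (auto intro!: derivative_eq_intros bounded_linear.has_derivative[OF bounded_linear_vec_nth])
    ultimately have "((\<lambda>x. flat j (c * x $ i + d)) has_derivative
      (\<lambda>h. (flat (j + 2) (c * x $ i + d) - real j * flat (j + 1) (c * x $ i + d)) * (c * h $ i))) (at x)"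
      by (rule has_derivative_compose[rotated])
    moreover have "(\<Sum>k\<in>UNIV. D k x * h $ k) =
      (flat (j + 2) (c * x $ i + d) - real j * flat (j + 1) (c * x $ i + d)) * (c * h $ i)" for h
    proof -
      have "(\<Sum>k\<in>UNIV. D k x * h $ k) = (\<Sum>k\<in>{i}. D k x * h $ k)"
        by (rule sum.mono_neutral_right) (auto simp: D_def)
      then show ?thesis by (simp add: D_def algebra_simps)
    qed
    ultimately show ?thesis by simp
  qed
  ultimately show ?case by blast
next
  case (add f g)
  then obtain D E where
    D: "\<And>i. D i \<in> flat_algebra" "\<And>x. (f has_derivative (\<lambda>h. \<Sum>i\<in>UNIV. D i x * h $ i)) (at x)" and
    E: "\<And>i. E i \<in> flat_algebra" "\<And>x. (g has_derivative (\<lambda>h. \<Sum>i\<in>UNIV. E i x * h $ i)) (at x)"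
    by blast
  show ?case
  proof (rule exI[of _ "\<lambda>i x. D i x + E i x"], intro conjI allI)
    show "(\<lambda>x. D i x + E i x) \<in> flat_algebra" for i
      by (intro flat_algebra.add D E)
    show "((\<lambda>x. f x + g x) has_derivative (\<lambda>h. \<Sum>i\<in>UNIV. (D i x + E i x) * h $ i)) (at x)" for x
      using has_derivative_add[OF D(2)[of x] E(2)[of x]]
      by (simp add: sum.distrib distrib_right)
  qed
next
  case (mult f g)
  then obtain D E where
    D: "\<And>i. D i \<in> flat_algebra" "\<And>x. (f has_derivative (\<lambda>h. \<Sum>i\<in>UNIV. D i x * h $ i)) (at x)" and
    E: "\<And>i. E i \<in> flat_algebra" "\<And>x. (g has_derivative (\<lambda>h. \<Sum>i\<in>UNIV. E i x * h $ i)) (at x)"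
    by blast
  show ?case
  proof (rule exI[of _ "\<lambda>i x. f x * E i x + D i x * g x"], intro conjI allI)
    show "(\<lambda>x. f x * E i x + D i x * g x) \<in> flat_algebra" for i
      by (intro flat_algebra.add flat_algebra.mult D E mult)
    show "((\<lambda>x. f x * g x) has_derivative
        (\<lambda>h. \<Sum>i\<in>UNIV. (f x * E i x + D i x * g x) * h $ i)) (at x)" for x
      using has_derivative_mult[OF D(2)[of x] E(2)[of x]]
      by (simp add: sum.distrib sum_distrib_left sum_distrib_right algebra_simps)
  qed
qed

lemma partial_deriv_flat_algebra:
  assumes "f \<in> flat_algebra"
  shows "partial_deriv i f \<in> flat_algebra"
proof -
  obtain D where D: "\<And>i. D i \<in> flat_algebra"
    "\<And>x. (f has_derivative (\<lambda>h. \<Sum>i\<in>UNIV. D i x * h $ i)) (at x)"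
    using flat_algebra_has_derivative[OF assms] by blast
  have "partial_deriv i f x = D i x" for x
  proof -
    have "partial_deriv i f x = (\<Sum>k\<in>UNIV. D k x * axis i 1 $ k)"
      unfolding partial_deriv_def frechet_derivative_at[OF D(2), symmetric] ..
    also have "\<dots> = (\<Sum>k\<in>{i}. D k x * axis i 1 $ k)"
      by (rule sum.mono_neutral_right) (auto simp: axis_def)
    finally show ?thesis by (simp add: axis_def)
  qed
  then have "partial_deriv i f = D i" by blast
  then show ?thesis using D(1) by simp
qed

text \<open>
  Every member is differentiable with partial derivatives in the same algebra, so differentiation
  can be repeated any number of times.
\<close>
lemma C_k_flat_algebra:
  "f \<in> flat_algebra \<Longrightarrow> C_k m f"
proof (induction m arbitrary: f)
  case 0
  then have "f differentiable (at x)" for x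
    using flat_algebra_has_derivative[of f] unfolding differentiable_def by blast
  then show ?case
    by (auto intro: continuous_at_imp_continuous_on differentiable_imp_continuous_within)
next
  case (Suc m)
  then show ?case
    using flat_algebra_has_derivative[of f] partial_deriv_flat_algebra
    by (auto simp: differentiable_def)
qed

lemma flat_algebra_prod:
  assumes "finite J" "\<And>j. j \<in> J \<Longrightarrow> f j \<in> flat_algebra"
  shows "(\<lambda>x. \<Prod>j\<in>J. f j x) \<in> flat_algebra"
  using assms by (induction J rule: finite_induct) (auto intro: flat_algebra.intros)

text \<open>
  Scaling the argument of \<^term>\<open>flat 0\<close> by \<open>m\<close> amounts to taking the \<open>m\<close>-th root of its value. As \<open>m\<close> grows, a
  product of such factors tends to \<open>1\<close> inside the box and stays \<open>0\<close> outside, and its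
  values always lie in \<open>[0, 1]\<close>.
\<close>
definition box_bump :: "nat \<Rightarrow> real ^ 'n \<Rightarrow> real ^ 'n \<Rightarrow> real ^ 'n \<Rightarrow> real" where
  "box_bump m a b x =
     (\<Prod>i\<in>UNIV. flat 0 (real m * (x $ i - a $ i)) * flat 0 (real m * (b $ i - x $ i)))"

lemma box_bump_eq_0:
  assumes "x \<notin> box a b"
  shows "box_bump m a b x = 0"
proof -
  obtain i where "x $ i - a $ i \<le> 0 \<or> b $ i - x $ i \<le> 0"
    using assms by (auto simp: mem_box_cart(1) not_less)
  then have "real m * (x $ i - a $ i) \<le> 0 \<or> real m * (b $ i - x $ i) \<le> 0"
    by (meson mult_nonneg_nonpos of_nat_0_le_iff)
  then have "flat 0 (real m * (x $ i - a $ i)) * flat 0 (real m * (b $ i - x $ i)) = 0"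
    by (auto simp: flat_def)
  then show ?thesis
    unfolding box_bump_def by (intro prod_zero) auto
qed

lemma flat_0_bounds: "0 \<le> flat 0 t" "flat 0 t \<le> 1"
  by (auto simp: flat_def)

lemma box_bump_bounds: "0 \<le> box_bump m a b x" "box_bump m a b x \<le> 1"
  unfolding box_bump_def
  by (auto intro!: prod_nonneg prod_le_1 mult_nonneg_nonneg mult_le_one flat_0_bounds)

lemma test_function_box_bump:
  assumes "cbox a b \<subseteq> \<Omega>"
  shows "test_function \<Omega> (box_bump m a b)"
proof -
  have *: "(\<lambda>x. flat 0 (real m * (x $ i - a $ i)) * flat 0 (real m * (b $ i - x $ i))) \<in> flat_algebra"
    for i
  proof -
    have "(\<lambda>x. flat 0 (real m * x $ i + (- real m * a $ i)) * flat 0 (- real m * x $ i + real m * b $ i))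
      \<in> flat_algebra"
      by (intro flat_algebra.intros)
    then show ?thesis by (simp add: algebra_simps)
  qed
  have "box_bump m a b \<in> flat_algebra"
    unfolding box_bump_def by (rule flat_algebra_prod) (auto intro: *)
  moreover have "box_bump m a b x = 0" if "x \<notin> cbox a b" for x
    using that box_subset_cbox by (intro box_bump_eq_0) blast
  ultimately show ?thesis
    unfolding test_function_def
    using C_k_flat_algebra assms by (intro conjI allI exI[of _ "cbox a b"]) auto
qed

lemma tendsto_flat_0: "(\<lambda>m. flat 0 (real m * t)) \<longlonglongrightarrow> of_bool (t > 0)"
proof (cases "t > 0")
  case True
  have "(\<lambda>m. exp (- inverse (real m * t))) \<longlonglongrightarrow> exp (- 0)"
    using True
    by (intro tendsto_intros tendsto_inverse_0_at_top filterlim_at_top_mult_tendsto_pos[OF tendsto_const])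
       (auto intro: filterlim_real_sequentially)
  moreover have "\<forall>\<^sub>F m in sequentially. exp (- inverse (real m * t)) = flat 0 (real m * t)"
    using eventually_gt_at_top[of 0] by eventually_elim (use True in \<open>auto simp: flat_def\<close>)
  ultimately show ?thesis
    using True by (simp add: Lim_transform_eventually)
next
  case False
  then show ?thesis
    by (auto simp: flat_def zero_less_mult_iff)
qed

lemma tendsto_box_bump: "(\<lambda>m. box_bump m a b x) \<longlonglongrightarrow> indicator (box a b) x"
proof -
  have "(\<lambda>m. box_bump m a b x) \<longlonglongrightarrow>
      (\<Prod>i\<in>UNIV. of_bool (x $ i - a $ i > 0) * of_bool (b $ i - x $ i > 0))"
    unfolding box_bump_def by (intro tendsto_intros tendsto_flat_0)
  moreover have "(\<Prod>i\<in>UNIV. of_bool (x $ i - a $ i > 0) * of_bool (b $ i - x $ i > 0)) =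
      (indicator (box a b) x :: real)"
    by (auto simp: indicator_def mem_box_cart(1))
  ultimately show ?thesis by simp
qed

section \<open>The fundamental lemma of the calculus of variations\<close>

text \<open>
  Boxes form an intersection-stable generator of the Borel sets, so the sets on which the integral
  vanishes, being a Dynkin system, contain all Borel sets; a density with this property is zero.
\<close>
lemma AE_box_eq_0_if_integrals_0:
  fixes g :: "'a::euclidean_space \<Rightarrow> real"
  assumes g: "integrable lborel g"
    and int: "\<And>a b. box a b \<subseteq> box c d \<Longrightarrow> (LINT x:box a b|lborel. g x) = 0"
  shows "AE x in lborel. x \<in> box c d \<longrightarrow> g x = 0"
proof -
  define f where "f = (\<lambda>x. indicator (box c d) x * g x)"
  have f: "integrable lborel f"
    unfolding f_def using integrable_mult_indicator[OF _ g, of "box c d"] by simp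
  have f_int: "(LINT x:A|lborel. f x) = 0" if "A \<in> sets borel" for A
  proof -
    let ?G = "range (\<lambda>(a, b). box a b :: 'a set)"
    \<comment> \<open>a box is cut down to a subbox of \<open>box c d\<close>\<close>
    have basic: "(LINT x:box a b|lborel. f x) = 0" for a b
    proof -
      obtain a' b' where ab: "box a b \<inter> box c d = box a' b'"
        by (rule that[OF box_Int_box])
      have "(LINT x:box a b|lborel. f x) = (LINT x:box a' b'|lborel. g x)"
        unfolding set_lebesgue_integral_def f_def ab[symmetric]
        by (simp add: indicator_inter_arith mult.assoc)
      also have "\<dots> = 0" using int ab by (metis Int_lower2)
      finally show ?thesis .
    qed
    have si: "set_integrable lborel A f" if "A \<in> sets borel" for A
      unfolding set_integrable_def using integrable_mult_indicator[OF _ f, of A] that by simp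
    have UNIV: "(LINT x:UNIV|lborel. f x) = 0"
    proof -
      have "(LINT x:UNIV|lborel. f x) = (LINT x:box c d|lborel. f x)"
        unfolding set_lebesgue_integral_def f_def by (intro Bochner_Integration.integral_cong) (auto simp: indicator_def)
      then show ?thesis using basic by simp
    qed
    have "Int_stable ?G" by (auto simp: Int_stable_def box_Int_box)
    moreover have "?G \<subseteq> Pow UNIV" by auto
    moreover have "A \<in> sigma_sets UNIV ?G" using that unfolding borel_eq_box by simp
    ultimately show ?thesis
    proof (induction rule: sigma_sets_induct_disjoint)
      case (basic A)
      then show ?case using \<open>\<And>a b. (LINT x:box a b|lborel. f x) = 0\<close> by auto
    next
      case empty
      then show ?case by (simp add: set_lebesgue_integral_def)
    next
      case (compl A)
      then have A: "A \<in> sets borel" unfolding borel_eq_box by simp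
      have "(LINT x:A \<union> (UNIV - A)|lborel. f x) =
          (LINT x:A|lborel. f x) + (LINT x:UNIV - A|lborel. f x)"
        by (intro set_integral_Un si) (use A in auto)
      then show ?case using compl UNIV by simp
    next
      case (union A)
      then have A: "A i \<in> sets borel" for i unfolding borel_eq_box by auto
      have "(LINT x:(\<Union>i. A i)|lborel. f x) = (\<Sum>i. LINT x:A i|lborel. f x)"
        using union.hyps(1) A
        by (intro lebesgue_integral_countable_add si)
           (auto simp: disjoint_family_on_def)
      then show ?case using union by simp
    qed
  qed
  have "AE x in lborel. f x = 0"
    using f by (rule density_unique_real) (auto simp: f_int)
  then show ?thesis
    by eventually_elim (auto simp: f_def)
qed

text \<open>
  The bumps are bounded by \<open>1\<close> and converge to the indicator of a box, so dominated convergence turns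
  the hypothesis on test functions into vanishing integrals over all boxes whose closure lies in
  \<open>\<Omega>\<close>. Countably many such open boxes cover \<open>\<Omega>\<close>, and the preceding lemma applies to each of them. A
  Borel representative \<open>g\<close> of \<open>f\<close> is used because boxes generate the Borel sets only.
\<close>
lemma fundamental_lemma_calculus_of_variations:
  fixes f :: "real ^ 'n \<Rightarrow> real"
  assumes \<Omega>: "open \<Omega>" and f: "set_integrable lebesgue \<Omega> f"
    and test: "\<And>\<psi>. test_function \<Omega> \<psi> \<Longrightarrow> (LINT x:\<Omega>|lebesgue. f x * \<psi> x) = 0"
  shows "AE x in lebesgue. x \<in> \<Omega> \<longrightarrow> f x = 0"
proof -
  define f\<Omega> where "f\<Omega> = (\<lambda>x. indicator \<Omega> x * f x)"
  have f\<Omega>: "integrable lebesgue f\<Omega>"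
    using f by (simp add: set_integrable_def f\<Omega>_def)
  then obtain g where g: "g \<in> borel_measurable lborel" and fg: "AE x in lborel. f\<Omega> x = g x"
    using completion_ex_borel_measurable_real[of f\<Omega> lborel] by auto
  have fg': "AE x in lebesgue. f\<Omega> x = g x"
    using fg by (rule AE_completion)
  have g_int: "integrable lebesgue g"
    by (rule integrable_cong_AE[THEN iffD1, OF borel_measurable_integrable[OF f\<Omega>] measurable_completion[OF g] fg' f\<Omega>])
  have g_int': "integrable lborel g"
    using integrable_completion[OF g] g_int by blast
  have box_int: "(LINT x:box a b|lborel. g x) = 0" if ab: "cbox a b \<subseteq> \<Omega>" for a b
  proof -
    have "(\<lambda>m. \<integral>x. box_bump m a b x * f\<Omega> x \<partial>lebesgue) \<longlonglongrightarrow> (\<integral>x. indicator (box a b) x * f\<Omega> x \<partial>lebesgue)"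
    proof (rule integral_dominated_convergence)
      show "integrable lebesgue (\<lambda>x. \<bar>f\<Omega> x\<bar>)" using f\<Omega> by simp
      show "AE x in lebesgue. (\<lambda>m. box_bump m a b x * f\<Omega> x) \<longlonglongrightarrow> indicator (box a b) x * f\<Omega> x"
        by (intro AE_I2 tendsto_mult tendsto_const tendsto_box_bump)
      show "AE x in lebesgue. norm (box_bump m a b x * f\<Omega> x) \<le> \<bar>f\<Omega> x\<bar>" for m
        using box_bump_bounds[of m a b] by (auto simp: abs_mult intro!: mult_left_le_one_le)
      have "continuous_on UNIV (box_bump m a b :: real ^ 'n \<Rightarrow> real)" for m
      proof -
        have "C_k 0 (box_bump m a b)"
          using test_function_box_bump[OF ab, of m] unfolding test_function_def by blast
        then show ?thesis by simp
      qed
      then have [measurable]: "(box_bump m a b :: real ^ 'n \<Rightarrow> real) \<in> borel_measurable lebesgue" for m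
        by (intro measurable_completion) (auto intro: borel_measurable_continuous_onI)
      have [measurable]: "f\<Omega> \<in> borel_measurable lebesgue" using f\<Omega> by auto
      show "(\<lambda>x. box_bump m a b x * f\<Omega> x) \<in> borel_measurable lebesgue" for m by measurable
      have [measurable]: "(indicator (box a b) :: real ^ 'n \<Rightarrow> real) \<in> borel_measurable lebesgue"
        by (intro measurable_completion) auto
      show "(\<lambda>x. indicator (box a b) x * f\<Omega> x) \<in> borel_measurable lebesgue" by measurable
    qed
    moreover have "(\<integral>x. box_bump m a b x * f\<Omega> x \<partial>lebesgue) = 0" for m
      using test[OF test_function_box_bump[OF ab, of m]]
      by (simp add: set_lebesgue_integral_def f\<Omega>_def mult_ac)
    ultimately have "(\<integral>x. indicator (box a b) x * f\<Omega> x \<partial>lebesgue) = 0"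
      by (simp add: LIMSEQ_const_iff)
    moreover have "(\<integral>x. indicator (box a b) x * f\<Omega> x \<partial>lebesgue) = (\<integral>x. indicator (box a b) x * g x \<partial>lebesgue)"
    proof (rule integral_cong_AE)
      have [measurable]: "f\<Omega> \<in> borel_measurable lebesgue" "g \<in> borel_measurable lebesgue"
        using f\<Omega> g_int by auto
      have [measurable]: "(indicator (box a b) :: real ^ 'n \<Rightarrow> real) \<in> borel_measurable lebesgue"
        by (intro measurable_completion) auto
      show "(\<lambda>x. indicator (box a b) x * f\<Omega> x) \<in> borel_measurable lebesgue"
        "(\<lambda>x. indicator (box a b) x * g x) \<in> borel_measurable lebesgue" by measurable
    qed (use fg' in eventually_elim, simp)
    moreover have "(\<integral>x. indicator (box a b) x * g x \<partial>lebesgue) = (\<integral>x. indicator (box a b) x * g x \<partial>lborel)"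
      using g by (intro integral_completion borel_measurable_times borel_measurable_indicator) auto
    ultimately show ?thesis by (simp add: set_lebesgue_integral_def)
  qed
  define \<F> where "\<F> = {box c d |c d. cbox c d \<subseteq> \<Omega>}"
  have "\<Omega> = \<Union>\<F>"
  proof (intro equalityI subsetI)
    fix x assume "x \<in> \<Omega>"
    then obtain c d where "cbox c d \<subseteq> \<Omega>" "x \<in> box c d"
      using \<Omega> by (meson open_contains_cbox)
    then show "x \<in> \<Union>\<F>" by (auto simp: \<F>_def)
  next
    fix x assume "x \<in> \<Union>\<F>"
    then show "x \<in> \<Omega>" using box_subset_cbox by (force simp: \<F>_def)
  qed
  moreover obtain \<F>' where "\<F>' \<subseteq> \<F>" "countable \<F>'" "\<Union>\<F>' = \<Union>\<F>"
    by (rule Lindelof[of \<F>]) (auto simp: \<F>_def)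
  moreover have "AE x in lborel. x \<in> N \<longrightarrow> g x = 0" if N\<F>: "N \<in> \<F>" for N
  proof -
    obtain c d where N: "N = box c d" and cd: "cbox c d \<subseteq> \<Omega>" using N\<F> unfolding \<F>_def by blast
    show ?thesis unfolding N
    proof (rule AE_box_eq_0_if_integrals_0[OF g_int'])
      fix a b assume ab: "box a b \<subseteq> box c d"
      show "(LINT x:box a b|lborel. g x) = 0"
      proof (cases "box a b = {}")
        case True
        then show ?thesis by (simp add: set_lebesgue_integral_def)
      next
        case False
        then have "cbox a b \<subseteq> cbox c d"
          using ab closure_mono[OF ab] by (metis bot.extremum_uniqueI closure_box)
        then show ?thesis using box_int cd by blast
      qed
    qed
  qed
  ultimately have "AE x in lborel. \<forall>N\<in>\<F>'. x \<in> N \<longrightarrow> g x = 0"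
    by (subst AE_ball_countable) auto
  then have "AE x in lborel. x \<in> \<Omega> \<longrightarrow> f x = 0"
    using fg
  proof eventually_elim
    case (elim x)
    then show ?case
      using \<open>\<Omega> = \<Union>\<F>\<close> \<open>\<Union>\<F>' = \<Union>\<F>\<close> by (auto simp: f\<Omega>_def indicator_def split: if_splits)
  qed
  then show ?thesis by (rule AE_completion)
qed

section \<open>Weak gradients and the Dirichlet form\<close>

lemma set_integrable_C0:
  assumes \<Omega>: "open \<Omega>" "bounded \<Omega>" and v: "v \<in> C0 \<Omega>"
  shows "set_integrable lebesgue \<Omega> v"
proof -
  have "integrable lborel (\<lambda>x. indicator (closure \<Omega>) x *\<^sub>R v x)"
    using borel_integrable_compact[of "closure \<Omega>" v] \<Omega> v by (simp add: C0_def)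
  then have "set_integrable lebesgue (closure \<Omega>) v"
    unfolding set_integrable_def using integrable_completion by (metis borel_measurable_integrable)
  then show ?thesis
    by (rule set_integrable_subset) (use \<Omega> closure_subset in auto)
qed

lemma L2_C0:
  assumes "open \<Omega>" "bounded \<Omega>" "v \<in> C0 \<Omega>"
  shows "L2 \<Omega> v"
  unfolding L2_def
proof
  show "set_borel_measurable lebesgue \<Omega> v"
    using set_integrable_C0[OF assms] by (auto simp: set_integrable_def set_borel_measurable_def)
  have "(\<lambda>x. (v x)\<^sup>2) \<in> C0 \<Omega>"
    using assms(3) by (auto simp: C0_def intro!: continuous_intros)
  then show "set_integrable lebesgue \<Omega> (\<lambda>x. (v x)\<^sup>2)"
    by (rule set_integrable_C0[OF assms(1,2)])
qed

lemma set_integrable_L2_mult: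
  assumes f: "L2 \<Omega> f" and g: "L2 \<Omega> g"
  shows "set_integrable lebesgue \<Omega> (\<lambda>x. f x * g x)"
  unfolding set_integrable_def
proof (rule Bochner_Integration.integrable_bound)
  show "integrable lebesgue (\<lambda>x. indicator \<Omega> x *\<^sub>R (f x)\<^sup>2 + indicator \<Omega> x *\<^sub>R (g x)\<^sup>2)"
    using f g by (auto simp: L2_def set_integrable_def)
  have [measurable]: "(\<lambda>x. indicator \<Omega> x * f x) \<in> borel_measurable lebesgue"
    "(\<lambda>x. indicator \<Omega> x * g x) \<in> borel_measurable lebesgue"
    using f g by (auto simp: L2_def set_borel_measurable_def)
  have "(\<lambda>x. indicator \<Omega> x *\<^sub>R (f x * g x)) = (\<lambda>x. (indicator \<Omega> x * f x) * (indicator \<Omega> x * g x))"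
    by (auto simp: indicator_def)
  then show "(\<lambda>x. indicator \<Omega> x *\<^sub>R (f x * g x)) \<in> borel_measurable lebesgue" by simp
  have "\<bar>s * t\<bar> \<le> s\<^sup>2 + t\<^sup>2" for s t :: real
  proof -
    have "2 * (\<bar>s\<bar> * \<bar>t\<bar>) \<le> s\<^sup>2 + t\<^sup>2"
      using sum_squares_bound[of "\<bar>s\<bar>" "\<bar>t\<bar>"] by simp
    then show ?thesis
      using zero_le_mult_iff[of "\<bar>s\<bar>" "\<bar>t\<bar>"] unfolding abs_mult by linarith
  qed
  then show "AE x in lebesgue. norm (indicator \<Omega> x *\<^sub>R (f x * g x))
      \<le> norm (indicator \<Omega> x *\<^sub>R (f x)\<^sup>2 + indicator \<Omega> x *\<^sub>R (g x)\<^sup>2)"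
    by (auto simp: indicator_def)
qed

lemma L2_axpy:
  assumes f: "L2 \<Omega> f" and g: "L2 \<Omega> g"
  shows "L2 \<Omega> (\<lambda>x. f x + c * g x)"
  unfolding L2_def
proof
  have [measurable]: "(\<lambda>x. indicator \<Omega> x * f x) \<in> borel_measurable lebesgue"
    "(\<lambda>x. indicator \<Omega> x * g x) \<in> borel_measurable lebesgue"
    using f g by (auto simp: L2_def set_borel_measurable_def)
  have "(\<lambda>x. indicator \<Omega> x *\<^sub>R (f x + c * g x)) = (\<lambda>x. indicator \<Omega> x * f x + c * (indicator \<Omega> x * g x))"
    by (auto simp: indicator_def)
  then show "set_borel_measurable lebesgue \<Omega> (\<lambda>x. f x + c * g x)"
    unfolding set_borel_measurable_def by simp
  have "set_integrable lebesgue \<Omega> (\<lambda>x. (f x * f x + (2 * c) * (f x * g x)) + c\<^sup>2 * (g x * g x))"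
    by (intro set_integral_add set_integrable_mult_right set_integrable_L2_mult f g)
  then show "set_integrable lebesgue \<Omega> (\<lambda>x. (f x + c * g x)\<^sup>2)"
    by (simp add: power2_eq_square algebra_simps)
qed

lemma C0_mult: "v \<in> C0 \<Omega> \<Longrightarrow> w \<in> C0 \<Omega> \<Longrightarrow> (\<lambda>x. v x * w x) \<in> C0 \<Omega>"
  by (auto simp: C0_def intro!: continuous_intros)

lemma C0_axpy: "v \<in> C0 \<Omega> \<Longrightarrow> w \<in> C0 \<Omega> \<Longrightarrow> (\<lambda>x. v x + c * w x) \<in> C0 \<Omega>"
  by (auto simp: C0_def intro!: continuous_intros)

lemma C0_const: "(\<lambda>_. c) \<in> C0 \<Omega>"
  by (auto simp: C0_def)

lemma test_function_C0:
  assumes "test_function \<Omega> \<psi>"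
  shows "\<psi> \<in> C0 \<Omega>" "partial_deriv i \<psi> \<in> C0 \<Omega>"
proof -
  have "C_k 0 \<psi>" "C_k (Suc 0) \<psi>"
    using assms unfolding test_function_def by blast+
  then show "\<psi> \<in> C0 \<Omega>" "partial_deriv i \<psi> \<in> C0 \<Omega>"
    by (auto simp: C0_def intro: continuous_on_subset)
qed

lemma is_weak_grad_axpy:
  assumes \<Omega>: "open \<Omega>" "bounded \<Omega>" and v: "v \<in> C0 \<Omega>" and w: "w \<in> C0 \<Omega>"
    and g: "is_weak_grad \<Omega> v g" and h: "is_weak_grad \<Omega> w h"
  shows "is_weak_grad \<Omega> (\<lambda>x. v x + c * w x) (\<lambda>x. g x + c *\<^sub>R h x)"
  unfolding is_weak_grad_def
proof (intro conjI allI impI)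
  show "L2 \<Omega> (\<lambda>x. (g x + c *\<^sub>R h x) $ i)" for i
    using g h L2_axpy[of \<Omega> "\<lambda>x. g x $ i" "\<lambda>x. h x $ i" c] by (simp add: is_weak_grad_def)
  fix \<psi> i assume \<psi>: "test_function \<Omega> \<psi>"
  note C0 = test_function_C0[OF \<psi>]
  have gh: "L2 \<Omega> (\<lambda>x. g x $ i)" "L2 \<Omega> (\<lambda>x. h x $ i)"
    using g h by (auto simp: is_weak_grad_def)
  have "(LINT x:\<Omega>|lebesgue. (v x + c * w x) * partial_deriv i \<psi> x) =
      (LINT x:\<Omega>|lebesgue. v x * partial_deriv i \<psi> x + c * (w x * partial_deriv i \<psi> x))"
    by (simp add: algebra_simps)
  also have "\<dots> = (LINT x:\<Omega>|lebesgue. v x * partial_deriv i \<psi> x) + c * (LINT x:\<Omega>|lebesgue. w x * partial_deriv i \<psi> x)"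
    using set_integrable_C0[OF \<Omega> C0_mult[OF v C0(2)]] set_integrable_C0[OF \<Omega> C0_mult[OF w C0(2)]]
    by (subst set_integral_add) auto
  also have "\<dots> = - ((LINT x:\<Omega>|lebesgue. g x $ i * \<psi> x) + c * (LINT x:\<Omega>|lebesgue. h x $ i * \<psi> x))"
    using g h \<psi> by (simp add: is_weak_grad_def)
  also have "\<dots> = - (LINT x:\<Omega>|lebesgue. g x $ i * \<psi> x + c * (h x $ i * \<psi> x))"
    using set_integrable_L2_mult[OF gh(1) L2_C0[OF \<Omega> C0(1)]] set_integrable_L2_mult[OF gh(2) L2_C0[OF \<Omega> C0(1)]]
    by (subst set_integral_add) auto
  also have "\<dots> = - (LINT x:\<Omega>|lebesgue. (g x + c *\<^sub>R h x) $ i * \<psi> x)"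
    by (simp add: algebra_simps)
  finally show "(LINT x:\<Omega>|lebesgue. (v x + c * w x) * partial_deriv i \<psi> x) =
    - (LINT x:\<Omega>|lebesgue. (g x + c *\<^sub>R h x) $ i * \<psi> x)" .
qed

text \<open>
  The weak gradient is unique almost everywhere. This is what makes \<^const>\<open>A_form\<close> bilinear
  although \<^const>\<open>weak_grad\<close> picks an arbitrary representative for each function separately.
\<close>
lemma is_weak_grad_unique:
  assumes \<Omega>: "open \<Omega>" "bounded \<Omega>"
    and g: "is_weak_grad \<Omega> v g" and h: "is_weak_grad \<Omega> v h"
  shows "AE x in lebesgue. x \<in> \<Omega> \<longrightarrow> g x = h x"
proof -
  have "AE x in lebesgue. x \<in> \<Omega> \<longrightarrow> g x $ i + (- 1) * h x $ i = 0" for i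
  proof (rule fundamental_lemma_calculus_of_variations[OF \<Omega>(1)])
    have gh: "L2 \<Omega> (\<lambda>x. g x $ i)" "L2 \<Omega> (\<lambda>x. h x $ i)"
      using g h by (auto simp: is_weak_grad_def)
    show "set_integrable lebesgue \<Omega> (\<lambda>x. g x $ i + (- 1) * h x $ i)"
      using set_integrable_L2_mult[OF L2_axpy[OF gh, of "-1"] L2_C0[OF \<Omega> C0_const[of 1]]] by simp
    fix \<psi> assume \<psi>: "test_function \<Omega> \<psi>"
    note \<psi>L2 = L2_C0[OF \<Omega> test_function_C0(1)[OF \<psi>]]
    have "(LINT x:\<Omega>|lebesgue. (g x $ i + (- 1) * h x $ i) * \<psi> x) =
        (LINT x:\<Omega>|lebesgue. g x $ i * \<psi> x - h x $ i * \<psi> x)"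
      by (simp add: algebra_simps)
    also have "\<dots> = (LINT x:\<Omega>|lebesgue. g x $ i * \<psi> x) - (LINT x:\<Omega>|lebesgue. h x $ i * \<psi> x)"
      by (intro set_integral_diff set_integrable_L2_mult gh \<psi>L2)
    also have "\<dots> = 0" using g h \<psi> by (simp add: is_weak_grad_def)
    finally show "(LINT x:\<Omega>|lebesgue. (g x $ i + (- 1) * h x $ i) * \<psi> x) = 0" .
  qed
  then have "AE x in lebesgue. \<forall>i. x \<in> \<Omega> \<longrightarrow> g x $ i + (- 1) * h x $ i = 0"
    by (subst AE_all_countable) auto
  then show ?thesis
    by eventually_elim (simp add: vec_eq_iff)
qed

lemma weak_grad_is_weak_grad: "H1 \<Omega> v \<Longrightarrow> is_weak_grad \<Omega> v (weak_grad \<Omega> v)"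
  unfolding H1_def weak_grad_def by (metis someI_ex)

lemma H1_axpy:
  assumes "open \<Omega>" "bounded \<Omega>" "v \<in> C0 \<Omega>" "w \<in> C0 \<Omega>" "H1 \<Omega> v" "H1 \<Omega> w"
  shows "H1 \<Omega> (\<lambda>x. v x + c * w x)"
  using assms is_weak_grad_axpy[OF assms(1-4)] L2_axpy unfolding H1_def by blast

lemma weak_grad_axpy:
  assumes "open \<Omega>" "bounded \<Omega>" "v \<in> C0 \<Omega>" "w \<in> C0 \<Omega>" "H1 \<Omega> v" "H1 \<Omega> w"
  shows "AE x in lebesgue. x \<in> \<Omega> \<longrightarrow>
    weak_grad \<Omega> (\<lambda>x. v x + c * w x) x = weak_grad \<Omega> v x + c *\<^sub>R weak_grad \<Omega> w x"
  by (rule is_weak_grad_unique[OF assms(1,2) weak_grad_is_weak_grad[OF H1_axpy[OF assms]]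
      is_weak_grad_axpy[OF assms(1-4) assms(5,6)[THEN weak_grad_is_weak_grad]]])

lemma set_integrable_weak_grad_inner:
  assumes "H1 \<Omega> v" "H1 \<Omega> w"
  shows "set_integrable lebesgue \<Omega> (\<lambda>x. weak_grad \<Omega> v x \<bullet> weak_grad \<Omega> w x)"
proof -
  have "set_integrable lebesgue \<Omega> (\<lambda>x. weak_grad \<Omega> v x $ i * weak_grad \<Omega> w x $ i)" for i
    using assms[THEN weak_grad_is_weak_grad] by (intro set_integrable_L2_mult) (auto simp: is_weak_grad_def)
  then show ?thesis
    unfolding set_integrable_def inner_vec_def inner_real_def scaleR_sum_right
    by (intro Bochner_Integration.integrable_sum)
qed

lemma A_form_sym: "A_form \<Omega> a v w = A_form \<Omega> a w v"
  by (simp add: A_form_def inner_commute)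

lemma A_form_nonneg: "0 \<le> c \<Longrightarrow> 0 \<le> A_form \<Omega> (\<lambda>_. c) v v"
  unfolding A_form_def set_lebesgue_integral_def
  by (intro integral_nonneg_AE) auto

lemma A_form_axpy:
  assumes \<Omega>: "open \<Omega>" "bounded \<Omega>" and C0: "v \<in> C0 \<Omega>" "w \<in> C0 \<Omega>" and H1: "H1 \<Omega> v" "H1 \<Omega> w" "H1 \<Omega> z"
  shows "A_form \<Omega> (\<lambda>_. s) (\<lambda>x. v x + c * w x) z =
    A_form \<Omega> (\<lambda>_. s) v z + c * A_form \<Omega> (\<lambda>_. s) w z"
proof -
  let ?G = "weak_grad \<Omega>"
  note int = set_integrable_weak_grad_inner
  have "AE x in lebesgue. indicator \<Omega> x *\<^sub>R (s * (?G (\<lambda>x. v x + c * w x) x \<bullet> ?G z x)) =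
      indicator \<Omega> x *\<^sub>R (s * (?G v x \<bullet> ?G z x) + c * (s * (?G w x \<bullet> ?G z x)))"
    using weak_grad_axpy[OF \<Omega> C0 H1(1,2), of c]
    by eventually_elim (auto simp: indicator_def inner_add_left algebra_simps)
  then have "A_form \<Omega> (\<lambda>_. s) (\<lambda>x. v x + c * w x) z =
      (LINT x:\<Omega>|lebesgue. s * (?G v x \<bullet> ?G z x) + c * (s * (?G w x \<bullet> ?G z x)))"
    unfolding A_form_def set_lebesgue_integral_def
  proof (rule integral_cong_AE[rotated 2])
    have "set_integrable lebesgue \<Omega> (\<lambda>x. s * (?G (\<lambda>x. v x + c * w x) x \<bullet> ?G z x))"
      by (intro set_integrable_mult_right int H1 H1_axpy \<Omega> C0)
    then show "(\<lambda>x. indicator \<Omega> x *\<^sub>R (s * (?G (\<lambda>x. v x + c * w x) x \<bullet> ?G z x))) \<in> borel_measurable lebesgue"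
      by (auto simp: set_integrable_def)
    have "set_integrable lebesgue \<Omega> (\<lambda>x. s * (?G v x \<bullet> ?G z x) + c * (s * (?G w x \<bullet> ?G z x)))"
      by (intro set_integral_add set_integrable_mult_right int H1)
    then show "(\<lambda>x. indicator \<Omega> x *\<^sub>R (s * (?G v x \<bullet> ?G z x) + c * (s * (?G w x \<bullet> ?G z x)))) \<in> borel_measurable lebesgue"
      by (auto simp: set_integrable_def)
  qed
  also have "\<dots> = A_form \<Omega> (\<lambda>_. s) v z + c * A_form \<Omega> (\<lambda>_. s) w z"
    unfolding A_form_def using int[OF H1(1,3)] int[OF H1(2,3)]
    by (subst set_integral_add) auto
  finally show ?thesis .
qed

section \<open>Riesz representation in finite-dimensional function spaces\<close>

text \<open>
  A homogeneous linear system with fewer equations than unknowns has a nontrivial solution. The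
  induction eliminates one equation at a time: the unknown \<open>p\<close> is a pivot for equation \<open>j\<close>.
\<close>
lemma exists_nontrivial_combination:
  fixes \<beta> :: "'s \<Rightarrow> 'j \<Rightarrow> real"
  assumes "finite J" "finite S" "card J < card S"
  shows "\<exists>c. (\<exists>s\<in>S. c s \<noteq> 0) \<and> (\<forall>j\<in>J. (\<Sum>s\<in>S. c s * \<beta> s j) = 0)"
  using assms
proof (induction J arbitrary: S \<beta> rule: finite_induct)
  case empty
  then have "S \<noteq> {}" by auto
  then show ?case by (intro exI[of _ "\<lambda>_. 1"]) auto
next
  case (insert j J)
  show ?case
  proof (cases "\<forall>s\<in>S. \<beta> s j = 0")
    case True
    have "card J < card S" using insert by simp
    then obtain c where "\<exists>s\<in>S. c s \<noteq> 0" "\<forall>j\<in>J. (\<Sum>s\<in>S. c s * \<beta> s j) = 0"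
      using insert.IH[of S \<beta>] insert.prems by blast
    then show ?thesis using True by (intro exI[of _ c]) auto
  next
    case False
    then obtain p where p: "p \<in> S" "\<beta> p j \<noteq> 0" by blast
    define S' where "S' = S - {p}"
    have S': "finite S'" "S = insert p S'" "p \<notin> S'"
      using p insert.prems by (auto simp: S'_def)
    have "card J < card S'"
      using insert.hyps insert.prems S' by simp
    then obtain c where c: "\<exists>s\<in>S'. c s \<noteq> 0"
      "\<And>i. i \<in> J \<Longrightarrow> (\<Sum>s\<in>S'. c s * (\<beta> s i - \<beta> s j / \<beta> p j * \<beta> p i)) = 0"
      using insert.IH[of S' "\<lambda>s i. \<beta> s i - \<beta> s j / \<beta> p j * \<beta> p i"] S' by blast
    define d where "d = c(p := - (\<Sum>s\<in>S'. c s * \<beta> s j) / \<beta> p j)"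
    have d_sum: "(\<Sum>s\<in>S. d s * \<beta> s i) =
        (\<Sum>s\<in>S'. c s * \<beta> s i) - (\<Sum>s\<in>S'. c s * \<beta> s j) / \<beta> p j * \<beta> p i" for i
    proof -
      have "(\<Sum>s\<in>S'. d s * \<beta> s i) = (\<Sum>s\<in>S'. c s * \<beta> s i)"
        using S' by (intro sum.cong) (auto simp: d_def)
      then show ?thesis using S' by (simp add: d_def)
    qed
    have "(\<Sum>s\<in>S. d s * \<beta> s i) = 0" if "i \<in> insert j J" for i
    proof (cases "i = j")
      case True
      then show ?thesis using p by (simp add: d_sum)
    next
      case False
      then have "(\<Sum>s\<in>S'. c s * (\<beta> s i - \<beta> s j / \<beta> p j * \<beta> p i)) = 0"
        using c(2) that by blast
      then show ?thesis
        by (simp add: d_sum algebra_simps sum_subtractf sum_distrib_left sum_distrib_right sum_divide_distrib)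
    qed
    moreover have "\<exists>s\<in>S. d s \<noteq> 0"
      using c(1) S' by (auto simp: d_def)
    ultimately show ?thesis by blast
  qed
qed

text \<open>
  A space of functions with a positive semidefinite symmetric form. Vectors of length zero are
  allowed because finite element functions are only determined on the closed domain: functions
  which differ elsewhere are distinct but at distance zero. Vector space structure and
  bilinearity are both expressed through the single operation \<open>v + c w\<close>.
\<close>
locale semi_inner_product =
  fixes V :: "('a \<Rightarrow> real) set" and a :: "('a \<Rightarrow> real) \<Rightarrow> ('a \<Rightarrow> real) \<Rightarrow> real"
  assumes zero_mem: "(\<lambda>_. 0) \<in> V"
    and axpy_mem: "v \<in> V \<Longrightarrow> w \<in> V \<Longrightarrow> (\<lambda>x. v x + c * w x) \<in> V"
    and sym: "v \<in> V \<Longrightarrow> w \<in> V \<Longrightarrow> a v w = a w v"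
    and axpy: "v \<in> V \<Longrightarrow> w \<in> V \<Longrightarrow> z \<in> V \<Longrightarrow> a (\<lambda>x. v x + c * w x) z = a v z + c * a w z"
    and nonneg: "v \<in> V \<Longrightarrow> 0 \<le> a v v"
begin

lemma zero_left: "z \<in> V \<Longrightarrow> a (\<lambda>_. 0) z = 0"
  using axpy[of "\<lambda>_. 0" "\<lambda>_. 0" z 1] zero_mem by simp

lemma axpy_right:
  "v \<in> V \<Longrightarrow> w \<in> V \<Longrightarrow> z \<in> V \<Longrightarrow> a z (\<lambda>x. v x + c * w x) = a z v + c * a z w"
  using axpy[of v w z c] sym axpy_mem by metis

lemma sum_mem:
  assumes "finite S" "\<And>s. s \<in> S \<Longrightarrow> e s \<in> V"
  shows "(\<lambda>x. \<Sum>s\<in>S. c s * e s x) \<in> V"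
  using assms
proof (induction S rule: finite_induct)
  case (insert s S)
  then have "(\<lambda>x. (\<Sum>s\<in>S. c s * e s x) + c s * e s x) \<in> V" by (intro axpy_mem) auto
  then show ?case using insert by (simp add: add.commute)
qed (simp add: zero_mem)

lemma sum_functional:
  assumes "finite S" "\<And>s. s \<in> S \<Longrightarrow> e s \<in> V"
    and lin: "\<And>v w c. v \<in> V \<Longrightarrow> w \<in> V \<Longrightarrow> l (\<lambda>x. v x + c * w x) = l v + c * l w"
  shows "l (\<lambda>x. \<Sum>s\<in>S. c s * e s x) = (\<Sum>s\<in>S. c s * l (e s))"
  using assms(1,2)
proof (induction S rule: finite_induct)
  case empty
  show ?case using lin[of "\<lambda>_. 0" "\<lambda>_. 0" 1] zero_mem by simp
next
  case (insert s S)
  then have "l (\<lambda>x. (\<Sum>s\<in>S. c s * e s x) + c s * e s x) = l (\<lambda>x. \<Sum>s\<in>S. c s * e s x) + c s * l (e s)"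
    by (intro lin sum_mem) auto
  then show ?case using insert by (simp add: add.commute)
qed

lemma sum_left:
  assumes "finite S" "\<And>s. s \<in> S \<Longrightarrow> e s \<in> V" "z \<in> V"
  shows "a (\<lambda>x. \<Sum>s\<in>S. c s * e s x) z = (\<Sum>s\<in>S. c s * a (e s) z)"
  using assms by (intro sum_functional) (auto intro: axpy)

text \<open>
  The degenerate case of the Cauchy-Schwarz inequality: otherwise \<open>a (v + t z) (v + t z)\<close> would be a
  nonconstant affine function of \<open>t\<close>, hence negative for some \<open>t\<close>.
\<close>

lemma null_vector_orthogonal:
  assumes z: "z \<in> V" "a z z = 0" and v: "v \<in> V"
  shows "a z v = 0"
proof (rule ccontr)
  assume nz: "a z v \<noteq> 0"
  \<comment> \<open>the parameter at which the affine function takes the value \<open>-1\<close>\<close>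
  define t where "t = - (a v v + 1) / (2 * a z v)"
  have t: "2 * t * a z v = - (a v v + 1)"
    using nz by (simp add: t_def)
  have "0 \<le> a (\<lambda>x. v x + t * z x) (\<lambda>x. v x + t * z x)"
    by (intro nonneg axpy_mem z v)
  also have "\<dots> = a v v + 2 * t * a z v"
    using z v sym[OF v z(1)] by (simp add: axpy axpy_right axpy_mem)
  also have "\<dots> = -1"
    using t by simp
  finally show False by simp
qed

definition orthonormal :: "('a \<Rightarrow> real) set \<Rightarrow> bool" where
  "orthonormal E \<longleftrightarrow> finite E \<and> E \<subseteq> V \<and> (\<forall>e\<in>E. \<forall>f\<in>E. a e f = of_bool (e = f))"

text \<open>
  Finite dimension enters as a bound on the size of orthonormal sets. For an orthonormal set \<open>E\<close> of
  maximal size, the representing vector is \<open>\<Sum>e\<in>E. l e * e\<close>. Indeed, the component \<open>z\<close> of any \<open>v\<close>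
  orthogonal to \<open>E\<close> has length zero, for it could otherwise be normalised and added to \<open>E\<close>; then neither
  the form nor \<open>l\<close> sees \<open>z\<close>.
\<close>
lemma riesz_representation:
  assumes bound: "\<And>E. orthonormal E \<Longrightarrow> card E \<le> N"
    and lin: "\<And>v w c. v \<in> V \<Longrightarrow> w \<in> V \<Longrightarrow> l (\<lambda>x. v x + c * w x) = l v + c * l w"
    and null: "\<And>v. v \<in> V \<Longrightarrow> a v v = 0 \<Longrightarrow> l v = 0"
  shows "\<exists>w\<in>V. \<forall>v\<in>V. a w v = l v"
proof -
  have "\<exists>E. orthonormal E \<and> (\<forall>E'. orthonormal E' \<longrightarrow> card E' \<le> card E)"
    by (rule ex_has_greatest_nat[of orthonormal "{}" card "Suc N"])
       (use bound in \<open>auto simp: le_imp_less_Suc orthonormal_def\<close>)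
  then obtain E where E: "orthonormal E" and max: "\<And>E'. orthonormal E' \<Longrightarrow> card E' \<le> card E"
    by blast
  then have fin: "finite E" and EV: "\<And>e. e \<in> E \<Longrightarrow> e \<in> V"
    and ortho: "\<And>e f. e \<in> E \<Longrightarrow> f \<in> E \<Longrightarrow> a e f = of_bool (e = f)"
    unfolding orthonormal_def by blast+
  define w where "w = (\<lambda>x. \<Sum>e\<in>E. l e * e x)"
  have "w \<in> V" unfolding w_def using fin EV by (intro sum_mem)
  moreover have "a w v = l v" if v: "v \<in> V" for v
  proof -
    \<comment> \<open>the orthogonal projection of \<open>v\<close> to the span of \<open>E\<close>\<close>
    define p where "p = (\<lambda>x. \<Sum>e\<in>E. a e v * e x)"
    have p: "p \<in> V" unfolding p_def using fin EV by (intro sum_mem)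
    define z where "z = (\<lambda>x. v x + (- 1) * p x)"
    have z: "z \<in> V" unfolding z_def by (intro axpy_mem v p)
    have az: "a z e = 0" if e: "e \<in> E" for e
    proof -
      have "a p e = (\<Sum>f\<in>E. a f v * a f e)"
        unfolding p_def by (intro sum_left fin EV e)
      also have "\<dots> = a e v"
        using fin e by (simp add: ortho[OF _ e] of_bool_def if_distrib cong: if_cong)
      finally show ?thesis
        unfolding z_def using axpy[OF v p EV[OF e], of "-1"] sym[OF v EV[OF e]] by simp
    qed
    have zz: "a z z = 0"
    proof (rule ccontr)
      assume nz: "a z z \<noteq> 0"
      then have pos: "a z z > 0" using nonneg[OF z] by simp
      define n where "n = (\<lambda>x. 0 + inverse (sqrt (a z z)) * z x)"
      have n: "n \<in> V" unfolding n_def by (intro axpy_mem zero_mem z)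
      have n_left: "a n u = inverse (sqrt (a z z)) * a z u" if "u \<in> V" for u
        unfolding n_def using axpy[OF zero_mem z that] zero_left[OF that] by simp
      have nn: "a n n = 1"
        using pos n_left[OF n] n_left[OF z] sym[OF z n] by (simp add: field_simps)
      have ne: "a n e = 0" "a e n = 0" if "e \<in> E" for e
        using n_left[OF EV[OF that]] az[OF that] sym[OF n EV[OF that]] by auto
      then have notin: "n \<notin> E" using nn by force
      have "orthonormal (insert n E)"
        unfolding orthonormal_def using fin EV n nn ne ortho notin by auto
      from max[OF this] show False using fin notin by simp
    qed
    have "l v = l (\<lambda>x. p x + 1 * z x)" by (simp add: z_def)
    also have "\<dots> = l p" using lin[OF p z, of 1] null[OF z zz] by simp
    also have "\<dots> = (\<Sum>e\<in>E. a e v * l e)"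
      unfolding p_def using fin EV lin by (intro sum_functional)
    finally have "l v = (\<Sum>e\<in>E. a e v * l e)" .
    moreover have "a w v = (\<Sum>e\<in>E. l e * a e v)"
      unfolding w_def by (intro sum_left fin EV v)
    ultimately show ?thesis by (simp add: mult.commute)
  qed
  ultimately show ?thesis by blast
qed

text \<open>
  If vectors are determined, up to length zero, by finitely many coordinates, then a larger
  orthonormal set would have a nontrivial linear combination \<open>\<Sum>e. c e * e\<close> of length zero. That
  vector is orthogonal to everything, and its product with a member \<open>f\<close> of the set is \<open>c f\<close>.
\<close>
lemma orthonormal_card_le:
  fixes coord :: "('a \<Rightarrow> real) \<Rightarrow> 'j \<Rightarrow> real"
  assumes J: "finite J"
    and coord: "\<And>E c. finite E \<Longrightarrow> E \<subseteq> V \<Longrightarrow> (\<And>j. j \<in> J \<Longrightarrow> (\<Sum>e\<in>E. c e * coord e j) = 0) \<Longrightarrow>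
      a (\<lambda>x. \<Sum>e\<in>E. c e * e x) (\<lambda>x. \<Sum>e\<in>E. c e * e x) = 0"
    and E: "orthonormal E"
  shows "card E \<le> card J"
proof (rule ccontr)
  assume "\<not> card E \<le> card J"
  moreover have fin: "finite E" and EV: "\<And>e. e \<in> E \<Longrightarrow> e \<in> V"
    and ortho: "\<And>e f. e \<in> E \<Longrightarrow> f \<in> E \<Longrightarrow> a e f = of_bool (e = f)"
    using E unfolding orthonormal_def by blast+
  ultimately obtain c where c: "\<exists>e\<in>E. c e \<noteq> 0" "\<And>j. j \<in> J \<Longrightarrow> (\<Sum>e\<in>E. c e * coord e j) = 0"
    using exists_nontrivial_combination[OF J fin, of coord] not_le by metis
  let ?v = "\<lambda>x. \<Sum>e\<in>E. c e * e x"
  have v: "?v \<in> V" using fin EV by (intro sum_mem)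
  have null: "a ?v ?v = 0" using fin EV c by (intro coord) auto
  from c obtain f where f: "f \<in> E" "c f \<noteq> 0" by blast
  have "0 = a ?v f" using null_vector_orthogonal[OF v null EV[OF f(1)]] by simp
  also have "\<dots> = (\<Sum>e\<in>E. c e * a e f)" by (intro sum_left fin EV f)
  also have "\<dots> = c f" using fin f by (simp add: ortho[OF _ f(1)] of_bool_def if_distrib cong: if_cong)
  finally show False using f by simp
qed

end

section \<open>The linear problem of one time step\<close>

lemma l2_inner_commute: "l2_inner \<Omega> f g = l2_inner \<Omega> g f"
  by (simp add: l2_inner_def mult.commute)

lemma l2_inner_nonneg: "0 \<le> l2_inner \<Omega> f f"
  unfolding l2_inner_def set_lebesgue_integral_def by (intro integral_nonneg_AE) auto

lemma l2_norm_power2: "(l2_norm \<Omega> f)\<^sup>2 = l2_inner \<Omega> f f"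
  by (simp add: l2_norm_def l2_inner_nonneg)

lemma l2_inner_scale: "l2_inner \<Omega> (\<lambda>x. c * f x) g = c * l2_inner \<Omega> f g"
  by (simp add: l2_inner_def mult.assoc)

lemma l2_inner_cong:
  assumes "open \<Omega>" "\<And>x. x \<in> \<Omega> \<Longrightarrow> f x = f' x" "\<And>x. x \<in> \<Omega> \<Longrightarrow> g x = g' x"
  shows "l2_inner \<Omega> f g = l2_inner \<Omega> f' g'"
  unfolding l2_inner_def using assms by (intro set_lebesgue_integral_cong) auto

lemma l2_inner_axpy:
  assumes \<Omega>: "open \<Omega>" "bounded \<Omega>" and C0: "v \<in> C0 \<Omega>" "w \<in> C0 \<Omega>" "z \<in> C0 \<Omega>"
  shows "l2_inner \<Omega> (\<lambda>x. v x + c * w x) z = l2_inner \<Omega> v z + c * l2_inner \<Omega> w z"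
proof -
  have "l2_inner \<Omega> (\<lambda>x. v x + c * w x) z = (LINT x:\<Omega>|lebesgue. v x * z x + c * (w x * z x))"
    by (simp add: l2_inner_def algebra_simps)
  also have "\<dots> = l2_inner \<Omega> v z + c * l2_inner \<Omega> w z"
    using set_integrable_C0[OF \<Omega> C0_mult[OF C0(1,3)]] set_integrable_C0[OF \<Omega> C0_mult[OF C0(2,3)]]
    by (subst set_integral_add) (auto simp: l2_inner_def)
  finally show ?thesis .
qed

lemma l2_inner_axpy_right:
  assumes "open \<Omega>" "bounded \<Omega>" "v \<in> C0 \<Omega>" "w \<in> C0 \<Omega>" "z \<in> C0 \<Omega>"
  shows "l2_inner \<Omega> z (\<lambda>x. v x + c * w x) = l2_inner \<Omega> z v + c * l2_inner \<Omega> z w"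
  using l2_inner_axpy[OF assms, of c] by (simp add: l2_inner_commute)

text \<open>
  The set where \<open>v\<close> does not vanish is open in \<open>\<Omega>\<close> and null, hence empty; by continuity \<open>v\<close> vanishes
  on the closure as well.
\<close>
lemma C0_eq_0_if_l2_inner_eq_0:
  assumes \<Omega>: "open \<Omega>" "bounded \<Omega>" and v: "v \<in> C0 \<Omega>" and 0: "l2_inner \<Omega> v v = 0"
    and x: "x \<in> closure \<Omega>"
  shows "v x = 0"
proof -
  have cont: "continuous_on (closure \<Omega>) v" using v by (simp add: C0_def)
  have "integrable lebesgue (\<lambda>x. indicator \<Omega> x *\<^sub>R (v x * v x))"
    using set_integrable_C0[OF \<Omega> C0_mult[OF v v]] by (simp add: set_integrable_def)
  then have "AE x in lebesgue. indicator \<Omega> x *\<^sub>R (v x * v x) = 0"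
    using 0 integral_nonneg_eq_0_iff_AE[of lebesgue "\<lambda>x. indicator \<Omega> x *\<^sub>R (v x * v x)"]
    by (simp add: l2_inner_def set_lebesgue_integral_def)
  then have ae: "AE x in lebesgue. x \<notin> {x \<in> \<Omega>. v x \<noteq> 0}"
    by eventually_elim (auto simp: indicator_def)
  define W where "W = {x \<in> \<Omega>. v x \<noteq> 0}"
  have "open (\<Omega> \<inter> v -` (- {0}))"
    using continuous_on_subset[OF cont closure_subset] \<Omega>
    by (intro continuous_open_preimage) auto
  moreover have "\<Omega> \<inter> v -` (- {0}) = W" by (auto simp: W_def)
  ultimately have W: "open W" by simp
  have "W \<in> null_sets lebesgue"
    using ae W by (subst AE_iff_null_sets) (auto simp: W_def)
  then have "negligible W" by (simp add: negligible_iff_null_sets)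
  then have "W = {}" using W open_not_negligible by blast
  then have "\<And>x. x \<in> \<Omega> \<Longrightarrow> v x = 0" by (auto simp: W_def)
  then show ?thesis
    using continuous_constant_on_closure[OF cont _ x, of 0] by blast
qed

lemma A_form_cong:
  assumes \<Omega>: "open \<Omega>" and eq: "\<And>x. x \<in> \<Omega> \<Longrightarrow> v x = v' x"
  shows "A_form \<Omega> a v w = A_form \<Omega> a v' w"
proof -
  have "(LINT x:\<Omega>|lebesgue. v x * f x) = (LINT x:\<Omega>|lebesgue. v' x * f x)" for f
    using assms by (intro set_lebesgue_integral_cong) auto
  then have "is_weak_grad \<Omega> v = is_weak_grad \<Omega> v'"
    by (auto simp: is_weak_grad_def fun_eq_iff)
  then show ?thesis by (simp add: A_form_def weak_grad_def)
qed

lemma V_h_coefficients: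
  assumes "v \<in> V_h \<Omega> \<T> k" "T \<in> \<T>"
  obtains b where
    "\<And>x. x \<in> T \<Longrightarrow> v x = (\<Sum>\<alpha> | (\<Sum>i\<in>UNIV. \<alpha> i) \<le> k. b \<alpha> * (\<Prod>i\<in>UNIV. (x $ i) ^ \<alpha> i))"
proof -
  obtain p where p: "p \<in> P_space k" "\<And>x. x \<in> T \<Longrightarrow> v x = p x"
    using assms unfolding V_h_def by blast
  obtain b where "p = (\<lambda>x. \<Sum>\<alpha> | (\<Sum>i\<in>UNIV. \<alpha> i) \<le> k. b \<alpha> * (\<Prod>i\<in>UNIV. (x $ i) ^ \<alpha> i))"
    using p(1) unfolding P_space_def mem_Collect_eq ..
  with p(2) show thesis by (intro that) simp
qed

lemma V_h_axpy:
  assumes \<Omega>: "open \<Omega>" "bounded \<Omega>" and v: "v \<in> V_h \<Omega> \<T> k" and w: "w \<in> V_h \<Omega> \<T> k"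
  shows "(\<lambda>x. v x + c * w x) \<in> V_h \<Omega> \<T> k"
proof -
  have "\<exists>p\<in>P_space k. \<forall>x\<in>T. v x + c * w x = p x" if T: "T \<in> \<T>" for T
  proof -
    let ?mono = "\<lambda>\<alpha> x. \<Prod>i\<in>UNIV. (x $ i) ^ \<alpha> i"
    obtain b where b: "\<And>x. x \<in> T \<Longrightarrow> v x = (\<Sum>\<alpha> | (\<Sum>i\<in>UNIV. \<alpha> i) \<le> k. b \<alpha> * ?mono \<alpha> x)"
      using V_h_coefficients[OF v T] by blast
    obtain d where d: "\<And>x. x \<in> T \<Longrightarrow> w x = (\<Sum>\<alpha> | (\<Sum>i\<in>UNIV. \<alpha> i) \<le> k. d \<alpha> * ?mono \<alpha> x)"
      using V_h_coefficients[OF w T] by blast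
    show ?thesis
    proof (rule bexI)
      show "(\<lambda>x. \<Sum>\<alpha> | (\<Sum>i\<in>UNIV. \<alpha> i) \<le> k. (b \<alpha> + c * d \<alpha>) * ?mono \<alpha> x) \<in> P_space k"
        unfolding P_space_def by (intro CollectI exI[of _ "\<lambda>\<alpha>. b \<alpha> + c * d \<alpha>"] refl)
      show "\<forall>x\<in>T. v x + c * w x = (\<Sum>\<alpha> | (\<Sum>i\<in>UNIV. \<alpha> i) \<le> k. (b \<alpha> + c * d \<alpha>) * ?mono \<alpha> x)"
        by (simp add: b d distrib_right sum.distrib sum_distrib_left mult.assoc)
    qed
  qed
  then show ?thesis
    using v w C0_axpy H1_axpy[OF \<Omega>] by (auto simp: V_h_def)
qed

lemma V_h_zero:
  assumes "open \<Omega>" "bounded \<Omega>" "u \<in> V_h \<Omega> \<T> k"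
  shows "(\<lambda>_. 0) \<in> V_h \<Omega> \<T> k"
  using V_h_axpy[OF assms(1,2,3,3), of "-1"] by simp

lemma finite_multi_indices: "finite {\<alpha> :: 'n::finite \<Rightarrow> nat. (\<Sum>i\<in>UNIV. \<alpha> i) \<le> k}"
proof (rule finite_subset)
  show "{\<alpha> :: 'n \<Rightarrow> nat. (\<Sum>i\<in>UNIV. \<alpha> i) \<le> k} \<subseteq> PiE UNIV (\<lambda>_. {..k})"
  proof
    fix \<alpha> :: "'n \<Rightarrow> nat" assume "\<alpha> \<in> {\<alpha>. (\<Sum>i\<in>UNIV. \<alpha> i) \<le> k}"
    then have "\<alpha> i \<le> k" for i
      using member_le_sum[of i UNIV \<alpha>] by simp
    then show "\<alpha> \<in> PiE UNIV (\<lambda>_. {..k})" by (auto simp: PiE_UNIV_domain)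
  qed
  show "finite (PiE (UNIV :: 'n set) (\<lambda>_. {..k}))"
    by (rule finite_PiE) simp_all
qed

text \<open>
  One time step with data \<open>(u, U)\<close>, where \<open>h\<close> stands for the continuous coefficient \<open>H (u x)\<close>.
\<close>

locale sav_step =
  fixes \<Omega> :: "(real ^ 'n) set" and \<T> :: "(real ^ 'n) set set" and k :: nat
    and \<epsilon> dt :: real and h u U :: "real ^ 'n \<Rightarrow> real"
  assumes \<Omega>: "open \<Omega>" "bounded \<Omega>"
    and elements: "finite \<T>" "closure \<Omega> = \<Union>\<T>"
    and dt: "dt > 0"
    and h: "h \<in> C0 \<Omega>"
    and u: "u \<in> V_h \<Omega> \<T> k"
    and U: "U \<in> C0 \<Omega>"
begin

abbreviation "V \<equiv> V_h \<Omega> \<T> k"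

abbreviation "A \<equiv> A_form \<Omega> (\<lambda>_. \<epsilon>\<^sup>2)"

abbreviation "ip \<equiv> l2_inner \<Omega>"

text \<open>
  Solving the pointwise equation for the auxiliary variable gives \<open>aux_update v\<close> in terms of the new
  state \<open>v\<close>. Inserting it in the Galerkin equation and moving everything that depends on \<open>v\<close> to the
  left yields the linear problem \<open>step_form v \<phi> = step_rhs \<phi>\<close>.
\<close>
definition step_form :: "(real ^ 'n \<Rightarrow> real) \<Rightarrow> (real ^ 'n \<Rightarrow> real) \<Rightarrow> real" where
  "step_form v \<phi> = ip v \<phi> / dt + A v \<phi> + 1 / 2 * ip (\<lambda>x. h x * v x) (\<lambda>x. h x * \<phi> x)"

definition step_rhs :: "(real ^ 'n \<Rightarrow> real) \<Rightarrow> real" where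
  "step_rhs \<phi> = ip u \<phi> / dt - ip (\<lambda>x. h x * U x) \<phi> + 1 / 2 * ip (\<lambda>x. h x * u x) (\<lambda>x. h x * \<phi> x)"

definition aux_update :: "(real ^ 'n \<Rightarrow> real) \<Rightarrow> real ^ 'n \<Rightarrow> real" where
  "aux_update v x = U x + 1 / 2 * h x * (v x - u x)"

lemma V_C0: "v \<in> V \<Longrightarrow> v \<in> C0 \<Omega>" and V_H1: "v \<in> V \<Longrightarrow> H1 \<Omega> v"
  by (auto simp: V_h_def)

lemmas ip_axpy = l2_inner_axpy[OF \<Omega>]
lemmas ip_axpy_right = l2_inner_axpy_right[OF \<Omega>]

lemma A_axpy: "v \<in> V \<Longrightarrow> w \<in> V \<Longrightarrow> z \<in> V \<Longrightarrow> A (\<lambda>x. v x + c * w x) z = A v z + c * A w z"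
  by (intro A_form_axpy \<Omega> V_C0 V_H1)

lemma ip_h_axpy:
  assumes "v \<in> C0 \<Omega>" "w \<in> C0 \<Omega>" "z \<in> C0 \<Omega>"
  shows "ip (\<lambda>x. h x * (v x + c * w x)) z = ip (\<lambda>x. h x * v x) z + c * ip (\<lambda>x. h x * w x) z"
  using ip_axpy[OF C0_mult[OF h assms(1)] C0_mult[OF h assms(2)] assms(3), of c]
  by (simp add: algebra_simps)

sublocale semi_inner_product V step_form
proof
  show "(\<lambda>_. 0) \<in> V" by (rule V_h_zero[OF \<Omega> u])
  show "(\<lambda>x. v x + c * w x) \<in> V" if "v \<in> V" "w \<in> V" for v w c
    using that by (rule V_h_axpy[OF \<Omega>])
  show "step_form v w = step_form w v" for v w
    unfolding step_form_def by (simp add: l2_inner_commute A_form_sym)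
  show "step_form (\<lambda>x. v x + c * w x) z = step_form v z + c * step_form w z"
    if "v \<in> V" "w \<in> V" "z \<in> V" for v w z c
    using that ip_axpy[of v w z c] A_axpy[of v w z c] ip_h_axpy[of v w "\<lambda>x. h x * z x" c]
    by (simp add: step_form_def V_C0 C0_mult[OF h] algebra_simps add_divide_distrib)
  show "0 \<le> step_form v v" if "v \<in> V" for v
    using dt by (simp add: step_form_def l2_inner_nonneg A_form_nonneg)
qed

text \<open>
  The mass term alone controls \<open>v\<close>, since the two other terms are nonnegative for every \<open>dt\<close>.
\<close>
lemma step_form_definite:
  assumes "v \<in> V" "step_form v v = 0" "x \<in> closure \<Omega>"
  shows "v x = 0"
proof -
  have "ip v v / dt \<le> step_form v v"
    by (simp add: step_form_def l2_inner_nonneg A_form_nonneg)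
  then have "ip v v = 0"
    using assms(2) dt l2_inner_nonneg[of \<Omega> v] by (simp add: divide_le_0_iff)
  then show ?thesis
    using C0_eq_0_if_l2_inner_eq_0[OF \<Omega> V_C0[OF assms(1)]] assms(3) by blast
qed

lemma step_form_cong:
  assumes "\<And>x. x \<in> \<Omega> \<Longrightarrow> v x = w x"
  shows "step_form v z = step_form w z"
proof -
  have "ip v z = ip w z" "ip (\<lambda>x. h x * v x) y = ip (\<lambda>x. h x * w x) y" for y
    using assms by (auto intro: l2_inner_cong[OF \<Omega>(1)])
  moreover have "A v z = A w z"
    by (intro A_form_cong \<Omega> assms)
  ultimately show ?thesis by (simp add: step_form_def)
qed

text \<open>
  The finite element space is finite-dimensional: the polynomial coefficients on the finitely many
  elements are coordinates which determine a function on \<open>\<Omega>\<close>. They are chosen for each function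
  separately and need not depend linearly on it; a linear combination of functions is evaluated
  through the same combination of their coefficients.
\<close>
lemma orthonormal_card_bounded: "\<exists>N. \<forall>E. orthonormal E \<longrightarrow> card E \<le> N"
proof -
  let ?M = "{\<alpha> :: 'n \<Rightarrow> nat. (\<Sum>i\<in>UNIV. \<alpha> i) \<le> k}"
  let ?mono = "\<lambda>\<alpha> (x :: real ^ 'n). \<Prod>i\<in>UNIV. (x $ i) ^ \<alpha> i"
  have ex: "\<exists>b. \<forall>x\<in>T. v x = (\<Sum>\<alpha>\<in>?M. b \<alpha> * ?mono \<alpha> x)" if "v \<in> V" "T \<in> \<T>" for v T
    by (rule V_h_coefficients[OF that]) blast
  define b where "b = (\<lambda>v T. SOME b. \<forall>x\<in>T. v x = (\<Sum>\<alpha>\<in>?M. b \<alpha> * ?mono \<alpha> x))"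
  have b: "v x = (\<Sum>\<alpha>\<in>?M. b v T \<alpha> * ?mono \<alpha> x)" if "v \<in> V" "T \<in> \<T>" "x \<in> T" for v T x
    using someI_ex[OF ex[OF that(1,2)]] that(3) unfolding b_def by blast
  have "card E \<le> card (\<T> \<times> ?M)" if "orthonormal E" for E
  proof (rule orthonormal_card_le[where coord = "\<lambda>v (T, \<alpha>). b v T \<alpha>", OF _ _ that])
    show "finite (\<T> \<times> ?M)" using elements finite_multi_indices by blast
    fix E c assume E: "finite E" "E \<subseteq> V"
      and 0: "\<And>j. j \<in> \<T> \<times> ?M \<Longrightarrow> (\<Sum>e\<in>E. c e * (case j of (T, \<alpha>) \<Rightarrow> b e T \<alpha>)) = 0"
    let ?v = "\<lambda>x. \<Sum>e\<in>E. c e * e x"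
    have v: "?v \<in> V" using E by (intro sum_mem) auto
    have "?v x = 0" if "x \<in> \<Omega>" for x
    proof -
      obtain T where T: "T \<in> \<T>" "x \<in> T" using \<open>x \<in> \<Omega>\<close> elements closure_subset by blast
      have "?v x = (\<Sum>e\<in>E. \<Sum>\<alpha>\<in>?M. c e * b e T \<alpha> * ?mono \<alpha> x)"
        using E T by (intro sum.cong) (auto simp: b sum_distrib_left mult.assoc)
      also have "\<dots> = (\<Sum>\<alpha>\<in>?M. (\<Sum>e\<in>E. c e * b e T \<alpha>) * ?mono \<alpha> x)"
        by (subst sum.swap) (simp add: sum_distrib_right)
      also have "\<dots> = 0"
        using 0[of "(T, _)"] T by (intro sum.neutral) auto
      finally show ?thesis .
    qed
    then have "step_form ?v ?v = step_form (\<lambda>_. 0) ?v" by (intro step_form_cong)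
    then show "step_form ?v ?v = 0" using zero_left[OF v] by simp
  qed
  then show ?thesis by blast
qed

lemma aux_update_C0:
  assumes "v \<in> C0 \<Omega>"
  shows "aux_update v \<in> C0 \<Omega>"
proof -
  have "(\<lambda>x. U x + 1 / 2 * (h x * (v x + (- 1) * u x))) \<in> C0 \<Omega>"
    by (intro C0_axpy C0_mult h U assms V_C0 u)
  then show ?thesis by (simp add: aux_update_def[abs_def] mult.assoc)
qed

lemma step_residual:
  assumes v: "v \<in> V" and \<phi>: "\<phi> \<in> V"
  shows "ip (\<lambda>x. (v x - u x) / dt) \<phi> + A v \<phi> + ip (\<lambda>x. h x * aux_update v x) \<phi> =
    step_form v \<phi> - step_rhs \<phi>"
proof -
  note C0 = V_C0[OF v] V_C0[OF u] V_C0[OF \<phi>]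
  have hh: "ip (\<lambda>x. h x * (h x * w x)) \<phi> = ip (\<lambda>x. h x * w x) (\<lambda>x. h x * \<phi> x)" for w
    by (simp add: l2_inner_def mult_ac)
  have "ip (\<lambda>x. h x * aux_update v x) \<phi> =
      ip (\<lambda>x. (h x * U x + 1 / 2 * (h x * (h x * v x))) + (- 1 / 2) * (h x * (h x * u x))) \<phi>"
    by (simp add: aux_update_def algebra_simps diff_divide_distrib)
  also have "\<dots> = ip (\<lambda>x. h x * U x) \<phi> + 1 / 2 * ip (\<lambda>x. h x * (h x * v x)) \<phi>
      + (- 1 / 2) * ip (\<lambda>x. h x * (h x * u x)) \<phi>"
    unfolding ip_axpy[OF C0_axpy[OF C0_mult[OF h U] C0_mult[OF h C0_mult[OF h V_C0[OF v]]]]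
        C0_mult[OF h C0_mult[OF h V_C0[OF u]]] V_C0[OF \<phi>]]
      ip_axpy[OF C0_mult[OF h U] C0_mult[OF h C0_mult[OF h V_C0[OF v]]] V_C0[OF \<phi>]] ..
  finally have 1: "ip (\<lambda>x. h x * aux_update v x) \<phi> = \<dots>" .
  have "ip (\<lambda>x. (v x - u x) / dt) \<phi> = ip (\<lambda>x. 1 / dt * (v x + (- 1) * u x)) \<phi>"
    by (simp add: diff_divide_distrib)
  also have "\<dots> = 1 / dt * (ip v \<phi> + (- 1) * ip u \<phi>)"
    unfolding l2_inner_scale ip_axpy[OF C0] ..
  finally have 2: "ip (\<lambda>x. (v x - u x) / dt) \<phi> = ip v \<phi> / dt - ip u \<phi> / dt"
    by (simp add: diff_divide_distrib)
  show ?thesis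
    unfolding 1 2 hh step_form_def step_rhs_def by simp
qed

end

section \<open>Unique solvability and energy dissipation\<close>

context sav_step begin

text \<open>
  Eliminating the auxiliary variable decouples the scheme into a linear problem for the new state and
  an explicit formula.
\<close>
lemma scheme_solution_iff:
  assumes H: "h = (\<lambda>x. H (u x))"
  shows "scheme_solution \<Omega> \<T> k \<epsilon> H dt u U v W \<longleftrightarrow>
    v \<in> V \<and> (\<forall>x\<in>closure \<Omega>. W x = aux_update v x) \<and> (\<forall>\<phi>\<in>V. step_form v \<phi> = step_rhs \<phi>)"
    (is "?scheme \<longleftrightarrow> ?eliminated")
proof -
  have pointwise: "(W x - U x) / dt = 1 / 2 * h x * ((v x - u x) / dt) \<longleftrightarrow> W x = aux_update v x" for x
  proof -
    have "1 / 2 * h x * ((v x - u x) / dt) = (1 / 2 * h x * (v x - u x)) / dt"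
      by simp
    then have "(W x - U x) / dt = 1 / 2 * h x * ((v x - u x) / dt) \<longleftrightarrow>
        W x - U x = 1 / 2 * h x * (v x - u x)"
      using dt by (simp only: divide_cancel_right) simp
    then show ?thesis unfolding aux_update_def by linarith
  qed
  have galerkin: "ip (\<lambda>x. (v x - u x) / dt) \<phi> = - A v \<phi> - ip (\<lambda>x. h x * W x) \<phi> \<longleftrightarrow>
      step_form v \<phi> = step_rhs \<phi>"
    if "v \<in> V" "\<phi> \<in> V" and W: "\<forall>x\<in>closure \<Omega>. W x = aux_update v x" for \<phi>
  proof -
    have "ip (\<lambda>x. h x * W x) \<phi> = ip (\<lambda>x. h x * aux_update v x) \<phi>"
      using W closure_subset[of \<Omega>] by (intro l2_inner_cong[OF \<Omega>(1)]) auto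
    then show ?thesis using step_residual[OF that(1,2)] by auto
  qed
  have cont: "W \<in> C0 \<Omega>" if "v \<in> V" "\<forall>x\<in>closure \<Omega>. W x = aux_update v x"
    using aux_update_C0[OF V_C0[OF that(1)]] that(2)
    unfolding C0_def mem_Collect_eq by (metis continuous_on_cong)
  have Hu: "H (u x) = h x" for x by (simp add: H)
  have "?scheme \<longleftrightarrow> v \<in> V \<and> W \<in> C0 \<Omega> \<and>
      (\<forall>\<phi>\<in>V. ip (\<lambda>x. (v x - u x) / dt) \<phi> = - A v \<phi> - ip (\<lambda>x. h x * W x) \<phi>) \<and>
      (\<forall>x\<in>closure \<Omega>. W x = aux_update v x)"
    unfolding scheme_solution_def pointwise[symmetric] Hu by (rule refl)
  also have "\<dots> \<longleftrightarrow> ?eliminated"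
    using galerkin cont by blast
  finally show ?thesis .
qed

lemma step_rhs_axpy:
  assumes "v \<in> V" "w \<in> V"
  shows "step_rhs (\<lambda>x. v x + c * w x) = step_rhs v + c * step_rhs w"
proof -
  note C0 = V_C0[OF assms(1)] V_C0[OF assms(2)]
  have "ip z (\<lambda>x. h x * (v x + c * w x)) = ip z (\<lambda>x. h x * v x) + c * ip z (\<lambda>x. h x * w x)"
    if "z \<in> C0 \<Omega>" for z
    using ip_h_axpy[OF C0 that] by (simp add: l2_inner_commute)
  from this[OF C0_mult[OF h V_C0[OF u]]] show ?thesis
    using ip_axpy_right[OF C0 V_C0[OF u], of c] ip_axpy_right[OF C0 C0_mult[OF h U], of c]
    by (simp add: step_rhs_def algebra_simps add_divide_distrib)
qed

lemma step_rhs_null: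
  assumes "v \<in> V" "step_form v v = 0"
  shows "step_rhs v = 0"
proof -
  have v: "v x = 0" if "x \<in> \<Omega>" for x
    using step_form_definite[OF assms] that closure_subset by blast
  have "ip z v = ip z (\<lambda>_. 0)" "ip z (\<lambda>x. h x * v x) = ip z (\<lambda>_. 0)" for z
    by (intro l2_inner_cong[OF \<Omega>(1)]; simp add: v)+
  then show ?thesis by (simp add: step_rhs_def l2_inner_def)
qed

lemma step_solvable: "\<exists>v\<in>V. \<forall>\<phi>\<in>V. step_form v \<phi> = step_rhs \<phi>"
proof -
  obtain N where "\<And>E. orthonormal E \<Longrightarrow> card E \<le> N"
    using orthonormal_card_bounded by blast
  then show ?thesis
    using step_rhs_axpy step_rhs_null by (rule riesz_representation)
qed

lemma step_unique:
  assumes v: "v \<in> V" and w: "w \<in> V" and x: "x \<in> closure \<Omega>"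
    and eq: "\<And>\<phi>. \<phi> \<in> V \<Longrightarrow> step_form v \<phi> = step_form w \<phi>"
  shows "v x = w x"
proof -
  let ?d = "\<lambda>x. v x + (- 1) * w x"
  have d: "?d \<in> V" by (intro axpy_mem v w)
  have "step_form ?d ?d = step_form v ?d + (- 1) * step_form w ?d"
    by (rule axpy[OF v w d])
  then have "step_form ?d ?d = 0" using eq[OF d] by simp
  from step_form_definite[OF d this x] show ?thesis by simp
qed

text \<open>
  The two polarisation identities \<open>2 \<langle>v, v - w\<rangle> = \<parallel>v\<parallel>\<^sup>2 - \<parallel>w\<parallel>\<^sup>2 + \<parallel>v - w\<parallel>\<^sup>2\<close> produce the differences of
  energies and the numerical dissipation.
\<close>
lemma polarization_C0:
  assumes v: "v \<in> C0 \<Omega>" and w: "w \<in> C0 \<Omega>"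
  shows "2 * ip v (\<lambda>x. v x - w x) = ip v v - ip w w + ip (\<lambda>x. v x - w x) (\<lambda>x. v x - w x)"
proof -
  let ?d = "\<lambda>x. v x + (- 1) * w x"
  have d: "?d \<in> C0 \<Omega>" by (intro C0_axpy v w)
  have "ip ?d ?d = ip v ?d - ip w ?d" "ip v ?d = ip v v - ip v w" "ip w ?d = ip w v - ip w w"
    using ip_axpy[OF v w d, of "-1"] ip_axpy_right[OF v w v, of "-1"] ip_axpy_right[OF v w w, of "-1"]
    by simp_all
  then show ?thesis using l2_inner_commute[of \<Omega> v w] by simp
qed

lemma polarization_A:
  assumes v: "v \<in> V" and w: "w \<in> V"
  shows "2 * A v (\<lambda>x. v x - w x) = A v v - A w w + A (\<lambda>x. v x - w x) (\<lambda>x. v x - w x)"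
proof -
  let ?d = "\<lambda>x. v x + (- 1) * w x"
  have d: "?d \<in> V" by (intro axpy_mem v w)
  have "A ?d ?d = A v ?d - A w ?d" "A v ?d = A v v - A v w" "A w ?d = A w v - A w w"
    using A_axpy[OF v w d, of "-1"] A_axpy[OF v w v, of "-1"] A_axpy[OF v w w, of "-1"]
    by (simp_all add: A_form_sym[of \<Omega> _ v "\<lambda>x. v x - w x"] A_form_sym[of \<Omega> _ w "\<lambda>x. v x - w x"]
      A_form_sym[of \<Omega> _ w v])
  then show ?thesis using A_form_sym[of \<Omega> _ v w] by simp
qed

text \<open>
  The Galerkin equation is tested with the increment \<open>d = v - u\<close>. The pointwise equation says
  \<open>h d = 2 (W - U)\<close>, so the nonlinear term becomes \<open>2 \<langle>W, W - U\<rangle>\<close>; polarisation does the rest.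
\<close>
lemma energy_dissipation:
  assumes H: "h = (\<lambda>x. H (u x))" and sol: "scheme_solution \<Omega> \<T> k \<epsilon> H dt u U v W"
  shows "energy \<Omega> \<epsilon> B v W = energy \<Omega> \<epsilon> B u U - 1 / dt * (l2_norm \<Omega> (\<lambda>x. v x - u x))\<^sup>2
    - 1 / 2 * A (\<lambda>x. v x - u x) (\<lambda>x. v x - u x) - (l2_norm \<Omega> (\<lambda>x. W x - U x))\<^sup>2"
proof -
  let ?d = "\<lambda>x. v x - u x" and ?D = "\<lambda>x. W x - U x"
  have v: "v \<in> V" and W: "W \<in> C0 \<Omega>"
    using sol unfolding scheme_solution_def by auto
  have d: "?d \<in> V" using axpy_mem[OF v u, of "-1"] by simp
  have test: "ip (\<lambda>x. ?d x / dt) ?d = - A v ?d - ip (\<lambda>x. h x * W x) ?d"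
    using sol d unfolding scheme_solution_def H by blast
  have "ip (\<lambda>x. ?d x / dt) ?d = 1 / dt * ip ?d ?d"
    using l2_inner_scale[of \<Omega> "1 / dt" ?d ?d] by simp
  moreover have "ip (\<lambda>x. h x * W x) ?d = 2 * ip W ?D"
  proof -
    have "W x = aux_update v x" if "x \<in> \<Omega>" for x
      using sol that closure_subset[of \<Omega>] unfolding scheme_solution_iff[OF H] by blast
    then have "ip (\<lambda>x. W x) (\<lambda>x. h x * ?d x) = ip (\<lambda>x. W x) (\<lambda>x. 2 * ?D x)"
      by (intro l2_inner_cong[OF \<Omega>(1)]) (simp_all add: aux_update_def)
    moreover have "ip (\<lambda>x. h x * W x) ?d = ip (\<lambda>x. W x) (\<lambda>x. h x * ?d x)"
      by (simp add: l2_inner_def mult_ac)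
    ultimately show ?thesis
      using l2_inner_scale[of \<Omega> 2 ?D W] by (simp add: l2_inner_commute)
  qed
  ultimately have "1 / dt * ip ?d ?d + A v ?d + 2 * ip W ?D = 0"
    using test by simp
  moreover have "energy \<Omega> \<epsilon> B y Y = 1 / 2 * A y y + ip Y Y - B * measure lebesgue \<Omega>" for y Y
    by (simp add: energy_def l2_inner_def power2_eq_square)
  ultimately show ?thesis
    using polarization_A[OF v u] polarization_C0[OF W U] by (simp add: l2_norm_power2)
qed

end

lemma continuous_on_H_fun:
  assumes "C1_potential I F F'" "\<And>w. w \<in> J \<Longrightarrow> w \<in> I \<and> F w + B > 0"
  shows "continuous_on J (H_fun F F' B)"
proof -
  have "continuous_on I F"
    using assms(1) by (intro DERIV_continuous_on[of I F F']) (simp add: C1_potential_def)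
  moreover have "continuous_on I F'" using assms(1) by (simp add: C1_potential_def)
  moreover have "J \<subseteq> I" using assms(2) by blast
  ultimately have "continuous_on J F" "continuous_on J F'"
    using continuous_on_subset by blast+
  moreover have "sqrt (F w + B) \<noteq> 0" if "w \<in> J" for w
    using assms(2)[OF that] by simp
  ultimately show ?thesis
    unfolding H_fun_def[abs_def] by (intro continuous_intros) auto
qed

theorem theorem3p1:
  fixes \<Omega> :: "(real ^ 'n) set" and \<T> :: "(real ^ 'n) set set" and k :: nat
    and \<epsilon> B dt \<sigma> :: real and I :: "real set" and F F' :: "real \<Rightarrow> real"
    and u U :: "real ^ 'n \<Rightarrow> real"
  assumes dim: "CARD('n) = 2 \<or> CARD('n) = 3"
    and domain: "open \<Omega>" "connected \<Omega>" "bounded \<Omega>" "\<Omega> \<noteq> {}"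
    and mesh: "mesh \<Omega> \<T>" "quasi_uniform \<sigma> \<T>"
    and k: "k \<ge> 1"
    and eps: "\<epsilon> > 0"
    and potential: "C1_potential I F F'"
    and B: "B \<ge> 0"
    and values_ok: "\<forall>x\<in>closure \<Omega>. u x \<in> I \<and> F (u x) + B > 0"
    and dt: "dt > 0"
    and u: "u \<in> V_h \<Omega> \<T> k"
    and U: "U \<in> C0 \<Omega>"
  shows
    "(\<exists>u' U'. scheme_solution \<Omega> \<T> k \<epsilon> (H_fun F F' B) dt u U u' U') \<and>
     (\<forall>u1 U1 u2 U2.
        scheme_solution \<Omega> \<T> k \<epsilon> (H_fun F F' B) dt u U u1 U1 \<and>
        scheme_solution \<Omega> \<T> k \<epsilon> (H_fun F F' B) dt u U u2 U2 \<longrightarrow>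
        (\<forall>x\<in>closure \<Omega>. u1 x = u2 x \<and> U1 x = U2 x)) \<and>
     (\<forall>u' U'. scheme_solution \<Omega> \<T> k \<epsilon> (H_fun F F' B) dt u U u' U' \<longrightarrow>
        energy \<Omega> \<epsilon> B u' U' =
          energy \<Omega> \<epsilon> B u U - 1 / dt * (l2_norm \<Omega> (\<lambda>x. u' x - u x))\<^sup>2
          - 1 / 2 * A_form \<Omega> (\<lambda>_. \<epsilon>\<^sup>2) (\<lambda>x. u' x - u x) (\<lambda>x. u' x - u x)
          - (l2_norm \<Omega> (\<lambda>x. U' x - U x))\<^sup>2)"
proof -
  let ?h = "\<lambda>x. H_fun F F' B (u x)"
  have "continuous_on (closure \<Omega>) u" using u by (simp add: V_h_def C0_def)
  moreover have "continuous_on (u ` closure \<Omega>) (H_fun F F' B)"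
    using values_ok by (intro continuous_on_H_fun[OF potential]) auto
  ultimately have h: "?h \<in> C0 \<Omega>"
    unfolding C0_def mem_Collect_eq by (rule continuous_on_compose[unfolded o_def])
  interpret sav_step \<Omega> \<T> k \<epsilon> dt ?h u U
    using domain mesh(1) dt h u U by unfold_locales (auto simp: mesh_def triangulation_def)
  note iff = scheme_solution_iff[of "H_fun F F' B", OF refl]
  show ?thesis
  proof (intro conjI allI impI ballI)
    obtain v where "v \<in> V" "\<forall>\<phi>\<in>V. step_form v \<phi> = step_rhs \<phi>"
      using step_solvable by blast
    then have "scheme_solution \<Omega> \<T> k \<epsilon> (H_fun F F' B) dt u U v (aux_update v)"
      unfolding iff by simp
    then show "\<exists>u' U'. scheme_solution \<Omega> \<T> k \<epsilon> (H_fun F F' B) dt u U u' U'" by blast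
  next
    fix u1 U1 u2 U2 x
    assume "scheme_solution \<Omega> \<T> k \<epsilon> (H_fun F F' B) dt u U u1 U1 \<and>
        scheme_solution \<Omega> \<T> k \<epsilon> (H_fun F F' B) dt u U u2 U2"
      and x: "x \<in> closure \<Omega>"
    then have sol: "u1 \<in> V" "u2 \<in> V" "U1 x = aux_update u1 x" "U2 x = aux_update u2 x"
      "\<And>\<phi>. \<phi> \<in> V \<Longrightarrow> step_form u1 \<phi> = step_form u2 \<phi>"
      unfolding iff by auto
    show "u1 x = u2 x" using step_unique[OF sol(1,2) x sol(5)] .
    then show "U1 x = U2 x" using sol by (simp add: aux_update_def)
  next
    fix u' U' assume "scheme_solution \<Omega> \<T> k \<epsilon> (H_fun F F' B) dt u U u' U'"
    then show "energy \<Omega> \<epsilon> B u' U' =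
          energy \<Omega> \<epsilon> B u U - 1 / dt * (l2_norm \<Omega> (\<lambda>x. u' x - u x))\<^sup>2
          - 1 / 2 * A_form \<Omega> (\<lambda>_. \<epsilon>\<^sup>2) (\<lambda>x. u' x - u x) (\<lambda>x. u' x - u x)
          - (l2_norm \<Omega> (\<lambda>x. U' x - U x))\<^sup>2"
      by (rule energy_dissipation[OF refl])
  qed
qed

end
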